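(* Let $L$ be a number field contained in $\mathbb{Q}(3^\infty)$, with Galois closure $\widehat{L}$. Then $\widehat{L}\subseteq \mathbb{Q}(3^\infty)$ and $\operatorname{Gal}(\widehat{L}/\mathbb{Q})$ is of generalized $S_3$-type. In particular, the exponent of $\operatorname{Gal}(\widehat{L}/\mathbb{Q})$ divides $6$.
   Context: Fix an algebraic closure $\overline{\mathbb{Q}}$ containing all fields considered. $\mathbb{Q}(3^\infty)$ is the compositum in $\overline{\mathbb{Q}}$ of all number fields of degree $3$ over $\mathbb{Q}$. A finite group is of generalized $S_3$-type if it is isomorphic to a subgroup of a finite direct product $S_3\times\cdots\times S_3$. *)

theory Defs
  imports "HOL-Algebra.Algebra" "HOL-Algebra.Algebraic_Closure_Type"
begin

text \<open>
  The ambient algebraic closure of the rationals is a type 'a of class alg_closed_field and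
  field_char_0 (all of whose elements are assumed algebraic in the theorem). Subfields are
  subsets of 'a, taken with respect to the ring structure on the whole type; the prime field is
  the set \<rat>.
\<close>

abbreviation ambient :: "'a :: {alg_closed_field, field_char_0} ring"
  where "ambient \<equiv> ring_of_type_algebra"

definition number_field :: "'a :: {alg_closed_field, field_char_0} set \<Rightarrow> bool"
  where "number_field K \<longleftrightarrow> subfield K ambient \<and> ring.finite_dimension ambient \<rat> K"

definition cubic_field :: "'a :: {alg_closed_field, field_char_0} set \<Rightarrow> bool"
  where "cubic_field K \<longleftrightarrow> subfield K ambient \<and> ring.dimension ambient 3 \<rat> K"

definition Q_three_infinity :: "'a :: {alg_closed_field, field_char_0} set"
  where "Q_three_infinity = generate_field ambient (\<Union> {K. cubic_field K})"

text \<open>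
  Normality: a rational irreducible polynomial with one root in N has all its roots in the
  ambient algebraic closure in N, i.e. it splits over N. Separability is automatic in
  characteristic 0.
\<close>

definition galois_over_Q :: "'a :: {alg_closed_field, field_char_0} set \<Rightarrow> bool"
  where "galois_over_Q N \<longleftrightarrow> subfield N ambient \<and> (\<forall>x\<in>N. algebraic x) \<and>
    (\<forall>p :: rat poly. Factorial_Ring.irreducible p \<longrightarrow>
       (\<exists>x\<in>N. poly (map_poly of_rat p) x = 0) \<longrightarrow>
       (\<forall>y. poly (map_poly of_rat p) y = 0 \<longrightarrow> y \<in> N))"

definition galois_closure :: "'a :: {alg_closed_field, field_char_0} set \<Rightarrow> 'a set"
  where "galois_closure L = \<Inter> {N. galois_over_Q N \<and> L \<subseteq> N}"

text \<open>
  Automorphisms of N are represented by functions that are undefined outside N, so that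
  distinct elements of the carrier are distinct automorphisms of N.
\<close>

definition galois_group ::
    "'a :: {alg_closed_field, field_char_0} set \<Rightarrow> ('a \<Rightarrow> 'a) monoid"
  where "galois_group N = BijGroup N
    \<lparr>carrier := {\<sigma> \<in> Bij N.
       \<sigma> \<in> ring_hom (ambient\<lparr>carrier := N\<rparr>) (ambient\<lparr>carrier := N\<rparr>) \<and>
       (\<forall>q\<in>\<rat>. \<sigma> q = q)}\<rparr>"

definition generalized_S3_type :: "('g, 'm) monoid_scheme \<Rightarrow> bool"
  where "generalized_S3_type G \<longleftrightarrow> group G \<and> finite (carrier G) \<and>
    (\<exists>(n :: nat) H. subgroup H (product_group {..<n} (\<lambda>_. sym_group 3)) \<and>
       G \<cong> (product_group {..<n} (\<lambda>_. sym_group 3))\<lparr>carrier := H\<rparr>)"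

text \<open>
  The order of an element of infinite order is 0, and the least common multiple of an unbounded
  set of natural numbers is 0, so exponent 0 means that the group has no finite exponent.
\<close>

definition group_exponent :: "('g, 'm) monoid_scheme \<Rightarrow> nat"
  where "group_exponent G = Lcm (group.ord G ` carrier G)"

end

(*
  Every field automorphism of the algebraic closure permutes the at most three roots of a cubic,
  and permutations f, g of three points satisfy f^6 = 1 and f^2 g^2 = g^2 f^2. Such identities hold
  on the whole compositum Q(3^infinity). Since automorphisms of a subfield extend to the algebraic
  closure (Zorn), the Galois group of every Galois subfield of Q(3^infinity) satisfies the same laws.
  Working with laws avoids showing directly that the class of groups of generalized S3-type is closed
  under quotients.

  Conversely, let a finite group satisfy x^6 = 1 and x^2 y^2 = y^2 x^2. Then the solutions of
  x^3 = 1 form an abelian normal subgroup T containing all squares and all commutators. To separate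
  an element g from 1 by a homomorphism to S3, pass to the quotient by a normal subgroup maximal
  among those not containing g, so that g lies in every nontrivial normal subgroup. Each x acts on T
  as an involution commuting with all conjugations, so its two eigenspaces are normal and one of
  them is trivial: x centralizes or inverts T. Hence T has order 1 or 3, it is its own centralizer
  if it is not trivial, and the group has a subgroup of index at most 3 not containing g. Its coset
  action is the required homomorphism.
*)

theory Submission
  imports Defs
begin

section \<open>Extension of homomorphisms between subfields\<close>

text \<open>A homomorphism defined on a subring is represented by its graph: a subring of the square of
  the field that is a functional relation. For subrings, functionality reduces to the last clause.\<close>

definition partial_hom :: "('a :: field_char_0 \<times> 'a) set \<Rightarrow> bool"
  where "partial_hom G \<longleftrightarrow> (\<forall>q. (of_rat q, of_rat q) \<in> G) \<and>
    (\<forall>x x' y y'. (x, x') \<in> G \<longrightarrow> (y, y') \<in> G \<longrightarrow> (x + y, x' + y') \<in> G \<and> (x * y, x' * y') \<in> G) \<and>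
    (\<forall>y. (0, y) \<in> G \<longrightarrow> y = 0)"

text \<open>The relation that \<open>G\<close> induces coefficientwise on polynomials. Both members
  of a pair are kept because \<open>G\<close> is a relation, so there is no function to map over the
  coefficients.\<close>

definition poly_pairs :: "('a :: field_char_0 \<times> 'a) set \<Rightarrow> ('a poly \<times> 'a poly) set"
  where "poly_pairs G = {(p, p'). \<forall>i. (coeff p i, coeff p' i) \<in> G}"

text \<open>Field endomorphisms of the whole ambient closure. The case \<open>q = 1\<close> of the
  first clause gives \<open>f 1 = 1\<close>, and injectivity follows as for any field
  homomorphism.\<close>

definition rational_hom :: "('a :: field_char_0 \<Rightarrow> 'a) \<Rightarrow> bool"
  where "rational_hom f \<longleftrightarrow> (\<forall>q. f (of_rat q) = of_rat q) \<and>
    (\<forall>x y. f (x + y) = f x + f y) \<and> (\<forall>x y. f (x * y) = f x * f y)"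

abbreviation rpoly :: "rat poly \<Rightarrow> 'a :: field_char_0 \<Rightarrow> 'a"
  where "rpoly p \<equiv> poly (map_poly of_rat p)"

section \<open>Evaluation of rational polynomials\<close>

lemma rpoly_simps [simp]:
  "rpoly 0 x = 0" "rpoly 1 x = 1" "rpoly (p + q) x = rpoly p x + rpoly q x"
  "rpoly (p * q) x = rpoly p x * rpoly q x"
proof -
  show "rpoly (p + q) x = rpoly p x + rpoly q x"
  proof -
    have "map_poly of_rat (p + q) = map_poly of_rat p + (map_poly of_rat q :: 'a poly)"
      by (intro poly_eqI) (simp add: coeff_map_poly of_rat_add)
    then show ?thesis by simp
  qed
  have "map_poly of_rat (p * q) = map_poly of_rat p * (map_poly of_rat q :: 'a poly)"
    by (intro poly_eqI) (simp add: coeff_map_poly coeff_mult of_rat_sum of_rat_mult)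
  then show "rpoly (p * q) x = rpoly p x * rpoly q x" by simp
qed simp_all

lemma rpoly_pCons [simp]: "rpoly (pCons a p) x = of_rat a + x * rpoly p x"
  by (simp add: map_poly_pCons)

lemma algebraic_rpoly:
  assumes "algebraic x"
  obtains p where "p \<noteq> 0" "rpoly p x = 0"
proof -
  obtain p where p: "\<And>i. coeff p i \<in> \<rat>" "p \<noteq> 0" "poly p x = 0"
    using assms algebraic_altdef by blast
  \<comment> \<open>A choice of rational preimages. The value 0 at 0 is fixed explicitly because
    \<open>map_poly\<close> commutes with taking coefficients only for functions that preserve
    0.\<close>
  define g where "g = (\<lambda>r :: 'a. if r = 0 then 0 else (SOME q :: rat. of_rat q = r))"
  have g: "of_rat (g r) = r" if "r \<in> \<rat>" for r
    using that unfolding g_def Rats_def by (auto intro!: someI_ex[of "\<lambda>q. of_rat q = r"])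
  have "map_poly of_rat (map_poly g p) = p"
    using g p(1) by (intro poly_eqI) (simp add: coeff_map_poly g_def)
  moreover from this have "map_poly g p \<noteq> 0" using p(2) by auto
  ultimately show ?thesis using that[of "map_poly g p"] p(3) by simp
qed

section \<open>Arithmetic in the graph of a partial homomorphism\<close>

lemma partial_hom_rat: "partial_hom G \<Longrightarrow> (of_rat q, of_rat q) \<in> G"
  by (auto simp: partial_hom_def)

lemma partial_hom_0: "partial_hom G \<Longrightarrow> (0, 0) \<in> G"
  using partial_hom_rat[of G 0] by simp

lemma partial_hom_1: "partial_hom G \<Longrightarrow> (1, 1) \<in> G"
  using partial_hom_rat[of G 1] by simp

lemma partial_hom_add: "partial_hom G \<Longrightarrow> (x, x') \<in> G \<Longrightarrow> (y, y') \<in> G \<Longrightarrow> (x + y, x' + y') \<in> G"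
  and partial_hom_mult: "partial_hom G \<Longrightarrow> (x, x') \<in> G \<Longrightarrow> (y, y') \<in> G \<Longrightarrow> (x * y, x' * y') \<in> G"
  and partial_hom_zeroD: "partial_hom G \<Longrightarrow> (0, y) \<in> G \<Longrightarrow> y = 0"
  by (auto simp: partial_hom_def)

lemma partial_hom_diff:
  assumes "partial_hom G" "(x, x') \<in> G" "(y, y') \<in> G"
  shows "(x - y, x' - y') \<in> G"
proof -
  have "(of_rat (-1) * y, of_rat (-1) * y') \<in> G"
    using assms partial_hom_rat partial_hom_mult by blast
  then have "(- y, - y') \<in> G" by simp
  then have "(x + - y, x' + - y') \<in> G" using assms partial_hom_add by blast
  then show ?thesis by simp
qed

lemma partial_hom_unique: "partial_hom G \<Longrightarrow> (x, y) \<in> G \<Longrightarrow> (x, z) \<in> G \<Longrightarrow> y = z"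
  using partial_hom_diff[of G x y x z] partial_hom_zeroD[of G "y - z"] by simp

lemma partial_hom_sum:
  assumes "partial_hom G" "\<And>i. i \<in> I \<Longrightarrow> (f i, g i) \<in> G"
  shows "(sum f I, sum g I) \<in> G"
  using assms(2)
  by (induction I rule: infinite_finite_induct) (auto simp: assms partial_hom_0 partial_hom_add)

lemma partial_hom_rpoly:
  assumes "partial_hom G" "(x, y) \<in> G"
  shows "(rpoly p x, rpoly p y) \<in> G"
  by (induction p) (use assms in \<open>auto intro!: partial_hom_add partial_hom_mult partial_hom_0 partial_hom_rat\<close>)

text \<open>If \<open>c\<close> has least degree among the nonzero rational polynomials vanishing at
  \<open>x\<close>, its constant term is nonzero, which expresses \<open>inverse x\<close> as a
  rational polynomial in \<open>x\<close>. As \<open>y\<close> is also a root of \<open>c\<close>,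
  the same formula gives \<open>inverse y\<close>. Thus a subring of algebraic elements is closed
  under inversion compatibly with \<open>G\<close>.\<close>

lemma partial_hom_inverse:
  assumes "partial_hom G" "algebraic x" "x \<noteq> 0" "(x, y) \<in> G"
  shows "(inverse x, inverse y) \<in> G" and "y \<noteq> 0"
proof -
  define P where "P c \<longleftrightarrow> c \<noteq> 0 \<and> rpoly c x = 0" for c
  obtain c0 where "P c0" using algebraic_rpoly[OF assms(2)] unfolding P_def by blast
  then obtain c where c: "P c" and min: "\<And>d. P d \<Longrightarrow> degree c \<le> degree d"
    using ex_has_least_nat[of P c0 degree] by blast
  obtain a d where cd: "c = pCons a d" by (cases c)
  have a0: "a \<noteq> 0"
  proof
    \<comment> \<open>Cancelling the nonzero factor \<open>x\<close> would leave \<open>d\<close>,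
      of smaller degree, vanishing at \<open>x\<close>.\<close>
    assume "a = 0"
    with c cd assms(3) have "P d" by (auto simp: P_def)
    with min have "degree c \<le> degree d" by blast
    moreover have "d \<noteq> 0" using \<open>P d\<close> by (simp add: P_def)
    ultimately show False using cd by simp
  qed
  have cx: "rpoly c x = 0" using c by (simp add: P_def)
  have "(rpoly c x, rpoly c y) \<in> G" by (rule partial_hom_rpoly[OF assms(1,4)])
  then have cy: "rpoly c y = 0" using cx partial_hom_zeroD[OF assms(1)] by simp
  have inv: "inverse z = of_rat (- 1 / a) * rpoly d z" "z \<noteq> 0" if "rpoly c z = 0" for z :: 'a
  proof -
    have e: "of_rat a + z * rpoly d z = 0" using that cd by simp
    have an: "of_rat a \<noteq> (0::'a)" using a0 by simp
    then show "z \<noteq> 0" using e by auto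
    moreover have "z * rpoly d z = - of_rat a" using e by (simp add: eq_neg_iff_add_eq_0 add.commute)
    ultimately show "inverse z = of_rat (- 1 / a) * rpoly d z"
      using an by (simp add: of_rat_divide of_rat_minus field_simps)
  qed
  have "(rpoly d x, rpoly d y) \<in> G" by (rule partial_hom_rpoly[OF assms(1,4)])
  then have "(of_rat (- 1 / a) * rpoly d x, of_rat (- 1 / a) * rpoly d y) \<in> G"
    using partial_hom_mult partial_hom_rat assms(1) by blast
  then show "(inverse x, inverse y) \<in> G" using inv cx cy by metis
  show "y \<noteq> 0" using inv(2) cy by blast
qed

section \<open>Polynomials with coefficients in a partial homomorphism\<close>

lemma poly_pairs_coeff: "(p, p') \<in> poly_pairs G \<Longrightarrow> (coeff p i, coeff p' i) \<in> G"
  by (simp add: poly_pairs_def)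

lemma poly_pairs_add:
  "partial_hom G \<Longrightarrow> (p, p') \<in> poly_pairs G \<Longrightarrow> (q, q') \<in> poly_pairs G \<Longrightarrow> (p + q, p' + q') \<in> poly_pairs G"
  by (simp add: poly_pairs_def partial_hom_add)

lemma poly_pairs_diff:
  "partial_hom G \<Longrightarrow> (p, p') \<in> poly_pairs G \<Longrightarrow> (q, q') \<in> poly_pairs G \<Longrightarrow> (p - q, p' - q') \<in> poly_pairs G"
  by (simp add: poly_pairs_def partial_hom_diff)

lemma poly_pairs_mult:
  "partial_hom G \<Longrightarrow> (p, p') \<in> poly_pairs G \<Longrightarrow> (q, q') \<in> poly_pairs G \<Longrightarrow> (p * q, p' * q') \<in> poly_pairs G"
  by (simp add: poly_pairs_def coeff_mult partial_hom_sum partial_hom_mult)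

lemma poly_pairs_monom: "partial_hom G \<Longrightarrow> (a, b) \<in> G \<Longrightarrow> (monom a n, monom b n) \<in> poly_pairs G"
  by (simp add: poly_pairs_def partial_hom_0)

lemma poly_pairs_rat: "partial_hom G \<Longrightarrow> (map_poly of_rat p, map_poly of_rat p) \<in> poly_pairs G"
  by (simp add: poly_pairs_def partial_hom_rat coeff_map_poly)

lemma poly_pairs_zeroD: "partial_hom G \<Longrightarrow> (0, p) \<in> poly_pairs G \<Longrightarrow> p = 0"
  by (intro poly_eqI) (auto simp: poly_pairs_def intro: partial_hom_zeroD)

text \<open>One-step extension: the second components of a pair of polynomials of minimal degree whose
  first component vanishes at \<open>\<alpha>\<close> have a root \<open>\<beta>\<close>, and \<open>\<alpha>\<close> can be mapped to it.\<close>

lemma partial_hom_extend: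
  fixes G :: "('a :: {alg_closed_field, field_char_0} \<times> 'a) set"
  assumes alg: "\<forall>x :: 'a. algebraic x" and G: "partial_hom G"
  obtains G' \<beta> where "partial_hom G'" "G \<subseteq> G'" "(\<alpha>, \<beta>) \<in> G'"
proof -
  define P where "P r \<longleftrightarrow> r \<in> poly_pairs G \<and> fst r \<noteq> 0 \<and> poly (fst r) \<alpha> = 0" for r
  obtain c where c: "c \<noteq> 0" "rpoly c \<alpha> = 0" using algebraic_rpoly alg by blast
  have "P (map_poly of_rat c, map_poly of_rat c)"
    using c poly_pairs_rat[OF G] by (simp add: P_def map_poly_eq_0_iff)
  then obtain r where r: "P r" and min': "\<And>s. P s \<Longrightarrow> degree (fst r) \<le> degree (fst s)"
    using ex_has_least_nat[of P _ "\<lambda>r. degree (fst r)"] by blast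
  obtain p p' where rp: "r = (p, p')" by force
  have pp: "(p, p') \<in> poly_pairs G" and p0: "p \<noteq> 0" and pa: "poly p \<alpha> = 0"
    using r rp by (auto simp: P_def)
  have min: "degree p \<le> degree q" if "(q, q') \<in> poly_pairs G" "q \<noteq> 0" "poly q \<alpha> = 0" for q q'
    using min'[of "(q, q')"] that rp by (auto simp: P_def)
  let ?n = "degree p"
  \<comment> \<open>The leading coefficient of \<open>p\<close> has a nonzero partner, so
    \<open>p'\<close> has at least the degree of \<open>p\<close> and therefore a root. The inverse
    lets division by \<open>p\<close> be mirrored on second components.\<close>
  have lc: "(inverse (lead_coeff p), inverse (coeff p' ?n)) \<in> G" "coeff p' ?n \<noteq> 0"
    using partial_hom_inverse[OF G, of "lead_coeff p" "coeff p' ?n"] alg p0 poly_pairs_coeff[OF pp]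
    by auto
  have "degree p > 0"
    using pa p0 by (metis degree_eq_zeroE gr0I mult_zero_right pCons_eq_0_iff poly_0 poly_pCons add.right_neutral)
  then have "degree p' > 0" using lc(2) le_degree[of p' ?n] by linarith
  then obtain \<beta> where \<beta>: "poly p' \<beta> = 0" using alg_closed_imp_poly_has_root by blast
  define G' where "G' = {(poly q \<alpha>, poly q' \<beta>) | q q'. (q, q') \<in> poly_pairs G}"
  \<comment> \<open>This makes the new relation functional. Subtracting a multiple of
    \<open>p\<close> lowers the degree of \<open>q\<close>; the mirrored subtraction of a multiple
    of \<open>p'\<close> does not change the value at \<open>\<beta>\<close>, which is a root of
    \<open>p'\<close>.\<close>
  have zero: "poly q' \<beta> = 0" if "(q, q') \<in> poly_pairs G" "poly q \<alpha> = 0" for q q'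
    using that
  proof (induction "degree q" arbitrary: q q' rule: less_induct)
    case less
    show ?case
    proof (cases "q = 0")
      case True
      then show ?thesis using less.prems(1) poly_pairs_zeroD[OF G, of q'] by simp
    next
      case False
      have le: "?n \<le> degree q" using min less.prems False by blast
      let ?m = "monom (lead_coeff q * inverse (lead_coeff p)) (degree q - ?n)"
      let ?m' = "monom (coeff q' (degree q) * inverse (coeff p' ?n)) (degree q - ?n)"
      define s where "s = q - ?m * p"
      define s' where "s' = q' - ?m' * p'"
      have "(?m, ?m') \<in> poly_pairs G"
        by (intro poly_pairs_monom[OF G] partial_hom_mult[OF G] lc poly_pairs_coeff less.prems)
      then have ss: "(s, s') \<in> poly_pairs G"
        unfolding s_def s'_def by (intro poly_pairs_diff[OF G] poly_pairs_mult[OF G] less.prems pp)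
      have sa: "poly s \<alpha> = 0" by (simp add: s_def less.prems pa)
      have "coeff s (degree q) = 0"
        using le p0 by (simp add: s_def coeff_monom_mult)
      moreover have "degree s \<le> degree q"
        unfolding s_def
        by (rule degree_diff_le[OF order.refl])
          (use le degree_mult_le[of ?m p] degree_monom_le[of "lead_coeff q * inverse (lead_coeff p)" "degree q - ?n"] in linarith)
      \<comment> \<open>The second alternative covers a constant \<open>q\<close>, whose degree
        cannot drop; then \<open>s'\<close> vanishes as well.\<close>
      ultimately have "degree s < degree q \<or> s = 0"
        by (metis leading_coeff_0_iff le_neq_implies_less)
      then have "poly s' \<beta> = 0"
        using less.hyps ss sa poly_pairs_zeroD[OF G, of s'] by (cases "s = 0") auto
      then show ?thesis by (simp add: s'_def \<beta>)
    qed
  qed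
  have const: "([:a:], [:b:]) \<in> poly_pairs G" if "(a, b) \<in> G" for a b
    using poly_pairs_monom[OF G that, of 0] by (simp add: monom_0)
  have sub: "G \<subseteq> G'"
  proof clarify
    fix a b assume "(a, b) \<in> G"
    then show "(a, b) \<in> G'" unfolding G'_def using const[of a b] by force
  qed
  have "partial_hom G'"
    unfolding partial_hom_def
  proof (intro conjI allI impI)
    show "(of_rat q, of_rat q) \<in> G'" for q using sub partial_hom_rat[OF G] by blast
    fix x x' y y' assume "(x, x') \<in> G'" "(y, y') \<in> G'"
    then obtain q q' s s' where e: "x = poly q \<alpha>" "x' = poly q' \<beta>" "y = poly s \<alpha>" "y' = poly s' \<beta>"
      and qs: "(q, q') \<in> poly_pairs G" "(s, s') \<in> poly_pairs G"
      unfolding G'_def by blast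
    have "(poly (q + s) \<alpha>, poly (q' + s') \<beta>) \<in> G'" "(poly (q * s) \<alpha>, poly (q' * s') \<beta>) \<in> G'"
      unfolding G'_def using poly_pairs_add[OF G qs] poly_pairs_mult[OF G qs] by blast+
    then show "(x + y, x' + y') \<in> G'" "(x * y, x' * y') \<in> G'" using e by simp_all
  next
    show "y = 0" if "(0, y) \<in> G'" for y
      using that zero unfolding G'_def by auto
  qed
  moreover have "(\<alpha>, \<beta>) \<in> G'"
  proof -
    \<comment> \<open>The indeterminate paired with itself evaluates to the pair of
      \<open>\<alpha>\<close> and \<open>\<beta>\<close>.\<close>
    have "(monom 1 1, monom 1 1) \<in> poly_pairs G" by (rule poly_pairs_monom[OF G partial_hom_1[OF G]])
    then have "(poly (monom 1 1) \<alpha>, poly (monom 1 1) \<beta>) \<in> G'" unfolding G'_def by blast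
    then show ?thesis by (simp add: poly_monom)
  qed
  ultimately show ?thesis using sub that by blast
qed

section \<open>Extension to the whole algebraic closure\<close>

lemma partial_hom_Union:
  assumes "C \<noteq> {}" "\<And>G. G \<in> C \<Longrightarrow> partial_hom G" "\<And>G H. G \<in> C \<Longrightarrow> H \<in> C \<Longrightarrow> G \<subseteq> H \<or> H \<subseteq> G"
  shows "partial_hom (\<Union>C)"
  unfolding partial_hom_def
proof (intro conjI allI impI)
  show "(of_rat q, of_rat q) \<in> \<Union>C" for q using assms partial_hom_rat by blast
  fix x x' y y' assume "(x, x') \<in> \<Union>C" "(y, y') \<in> \<Union>C"
  then obtain G where "G \<in> C" "(x, x') \<in> G" "(y, y') \<in> G" using assms(3) by blast
  then show "(x + y, x' + y') \<in> \<Union>C" "(x * y, x' * y') \<in> \<Union>C"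
    using assms(2) partial_hom_add partial_hom_mult by blast+
next
  show "y = 0" if "(0, y) \<in> \<Union>C" for y using that assms(2) partial_hom_zeroD by blast
qed

text \<open>Zorn's lemma gives a maximal extension. It is defined everywhere, since any further
  element could be adjoined by the one-step extension, and it is functional, so it is the graph of
  an endomorphism.\<close>

theorem partial_hom_extends_to_rational_hom:
  fixes G :: "('a :: {alg_closed_field, field_char_0} \<times> 'a) set"
  assumes alg: "\<forall>x :: 'a. algebraic x" and G: "partial_hom G"
  obtains f where "rational_hom f" "\<And>x y. (x, y) \<in> G \<Longrightarrow> f x = y"
proof -
  let ?A = "{H. partial_hom H \<and> G \<subseteq> H}"
  have "\<exists>M\<in>?A. \<forall>Y\<in>?A. M \<subseteq> Y \<longrightarrow> Y = M"
  proof (rule subset_Zorn_nonempty)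
    show "?A \<noteq> {}" using G by blast
    fix C assume C: "C \<noteq> {}" "subset.chain ?A C"
    then have CA: "C \<subseteq> ?A" and chain: "\<And>H K. H \<in> C \<Longrightarrow> K \<in> C \<Longrightarrow> H \<subseteq> K \<or> K \<subseteq> H"
      unfolding subset_chain_def by blast+
    have "partial_hom (\<Union>C)"
      by (rule partial_hom_Union[OF C(1) _ chain]) (use CA in blast)
    moreover obtain H where "H \<in> C" using C(1) by blast
    then have "G \<subseteq> \<Union>C" using CA by blast
    ultimately show "\<Union>C \<in> ?A" by simp
  qed
  then obtain M where M: "partial_hom M" "G \<subseteq> M"
    and max: "\<forall>Y\<in>?A. M \<subseteq> Y \<longrightarrow> Y = M" by blast
  have "\<exists>y. (x, y) \<in> M" for x
  proof -
    obtain G' y where G': "partial_hom G'" "M \<subseteq> G'" "(x, y) \<in> G'"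
      using partial_hom_extend[OF alg M(1)] .
    then have "G' = M" using max M(2) by simp
    then show ?thesis using G'(3) by blast
  qed
  then obtain f where f: "\<And>x. (x, f x) \<in> M" by metis
  have u: "(x, y) \<in> M \<Longrightarrow> f x = y" for x y using f partial_hom_unique[OF M(1)] by blast
  have "rational_hom f"
    unfolding rational_hom_def
    using u[OF partial_hom_rat[OF M(1)]] u[OF partial_hom_add[OF M(1) f f]] u[OF partial_hom_mult[OF M(1) f f]]
    by blast
  then show ?thesis using that u M(2) by blast
qed

text \<open>Sending \<open>rpoly q x\<close> to \<open>rpoly q y\<close> is well defined because
  \<open>p\<close> divides every rational polynomial vanishing at \<open>x\<close>; this partial
  homomorphism is then extended to the closure.\<close>

lemma conjugate_rational_hom:
  fixes x y :: "'a :: {alg_closed_field, field_char_0}"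
  assumes alg: "\<forall>x :: 'a. algebraic x" and p: "Factorial_Ring.irreducible p" "rpoly p x = 0" "rpoly p y = 0"
  obtains f where "rational_hom f" "f x = y"
proof -
  let ?G = "{(rpoly q x, rpoly q y) | q. True}"
  have zero: "rpoly q y = 0" if "rpoly q x = 0" for q
  proof -
    have "p dvd q"
    proof (rule ccontr)
      assume "\<not> p dvd q"
      then have "coprime p q" using p(1) prime_elem_imp_coprime irreducible_imp_prime_elem by blast
      \<comment> \<open>A Bezout identity for coprime \<open>p\<close> and \<open>q\<close>,
        evaluated at the common root \<open>x\<close>, would give 0 = 1.\<close>
      then obtain a b where "a * p + b * q = 1"
        by (metis bezout_coefficients_fst_snd coprime_iff_gcd_eq_1)
      then have "rpoly (a * p + b * q) x = 1" by simp
      then show False using that p(2) by simp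
    qed
    then show ?thesis using p(3) by (auto simp: dvd_def)
  qed
  have "partial_hom ?G"
    unfolding partial_hom_def
  proof (intro conjI allI impI)
    show "(of_rat q, of_rat q) \<in> ?G" for q
      by (auto intro!: exI[of _ "[:q:]"])
    fix a a' b b' assume "(a, a') \<in> ?G" "(b, b') \<in> ?G"
    then obtain r s where "a = rpoly r x" "a' = rpoly r y" "b = rpoly s x" "b' = rpoly s y" by blast
    then show "(a + b, a' + b') \<in> ?G" "(a * b, a' * b') \<in> ?G"
      by (auto intro: exI[of _ "r + s"] exI[of _ "r * s"])
  next
    show "z = 0" if "(0, z) \<in> ?G" for z using that zero by auto
  qed
  then obtain f where f: "rational_hom f" "\<And>a b. (a, b) \<in> ?G \<Longrightarrow> f a = b"
    using partial_hom_extends_to_rational_hom[OF alg] by blast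
  have "(x, y) \<in> ?G" by (auto intro!: exI[of _ "[:0, 1:]"])
  then show ?thesis using that f by blast
qed

section \<open>Subfields and their Galois groups\<close>

lemma ambient_simps [simp]:
  "carrier (ambient :: 'a :: {alg_closed_field, field_char_0} ring) = UNIV"
  "x \<otimes>\<^bsub>ambient\<^esub> y = x * (y :: 'a)" "x \<oplus>\<^bsub>ambient\<^esub> y = x + (y :: 'a)"
  "\<one>\<^bsub>ambient\<^esub> = (1 :: 'a)" "\<zero>\<^bsub>ambient\<^esub> = (0 :: 'a)"
  by (simp_all add: ring_of_type_algebra_def)

lemma ambient_a_inv [simp]: "\<ominus>\<^bsub>ambient\<^esub> x = - (x :: 'a :: {alg_closed_field, field_char_0})"
proof -
  interpret field "ambient :: 'a ring" by (rule field_from_type_algebra)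
  show "\<ominus>\<^bsub>ambient\<^esub> x = - x" by (rule minus_equality) simp_all
qed

lemma ambient_m_inv [simp]:
  "x \<noteq> 0 \<Longrightarrow> inv\<^bsub>ambient\<^esub> x = inverse (x :: 'a :: {alg_closed_field, field_char_0})"
proof -
  assume "x \<noteq> 0"
  interpret field "ambient :: 'a ring" by (rule field_from_type_algebra)
  show "inv\<^bsub>ambient\<^esub> x = inverse x" by (rule comm_inv_char) (simp_all add: \<open>x \<noteq> 0\<close>)
qed

lemma subfield_ambient_iff:
  fixes S :: "'a :: {alg_closed_field, field_char_0} set"
  shows "subfield S ambient \<longleftrightarrow> 1 \<in> S \<and> (\<forall>x\<in>S. - x \<in> S) \<and> (\<forall>x\<in>S. \<forall>y\<in>S. x + y \<in> S \<and> x * y \<in> S)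
    \<and> (\<forall>x\<in>S. x \<noteq> 0 \<longrightarrow> inverse x \<in> S)" (is "_ \<longleftrightarrow> ?R")
proof -
  interpret field "ambient :: 'a ring" by (rule field_from_type_algebra)
  show ?thesis
  proof
    assume S: "subfield S ambient"
    have "inverse x \<in> S" if "x \<in> S" "x \<noteq> 0" for x
      using subfield_m_inv(1)[OF S, of x] that by simp
    moreover have "subring S ambient" using S subfieldE(1) by blast
    note subringE[OF this]
    ultimately show ?R by simp
  next
    assume R: ?R
    have "subring S ambient" by (rule subringI) (use R in auto)
    then show "subfield S ambient" by (rule subfieldI') (use R in auto)
  qed
qed

lemma subfield_rat:
  assumes "subfield (S :: 'a :: {alg_closed_field, field_char_0} set) ambient"
  shows "of_rat q \<in> S"
proof -
  note S = assms[unfolded subfield_ambient_iff]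
  have one: "1 \<in> S" using S by blast
  have zero: "0 \<in> S" using S by (metis add.right_inverse)
  have nat: "of_nat n \<in> S" for n
    by (induction n) (use S zero in auto)
  have int: "of_int k \<in> S" for k
    by (cases k rule: int_cases2) (use S nat in auto)
  have inv: "inverse x \<in> S" if "x \<in> S" for x
    using S that zero by (cases "x = 0") auto
  show ?thesis
  proof (cases q)
    case (Fract a b)
    then have "of_rat q = (of_int a * inverse (of_int b) :: 'a)"
      by (simp add: of_rat_rat divide_inverse)
    then show ?thesis using S int inv by metis
  qed
qed

lemma subfield_Rats: "subfield (\<rat> :: 'a :: {alg_closed_field, field_char_0} set) ambient"
  by (simp add: subfield_ambient_iff)

lemma subfield_Inter:
  fixes F :: "'a :: {alg_closed_field, field_char_0} set set"
  assumes "\<And>S. S \<in> F \<Longrightarrow> subfield S ambient"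
  shows "subfield (\<Inter>F) ambient"
  using assms unfolding subfield_ambient_iff by blast

lemma subfield_generate: "subfield (generate_field ambient S) ambient"
proof -
  interpret field "ambient :: 'a ring" by (rule field_from_type_algebra)
  show ?thesis by (rule generate_field_is_subfield) simp
qed

lemma generate_field_least:
  assumes "subfield E ambient" "S \<subseteq> E"
  shows "generate_field ambient S \<subseteq> E"
proof -
  interpret field "ambient :: 'a ring" by (rule field_from_type_algebra)
  show ?thesis by (rule generate_field_min_subfield1) (use assms in auto)
qed

section \<open>Endomorphisms of the algebraic closure\<close>

lemma rational_hom_rat: "rational_hom f \<Longrightarrow> f (of_rat q) = of_rat q"
  and rational_hom_add: "rational_hom f \<Longrightarrow> f (x + y) = f x + f y"
  and rational_hom_mult: "rational_hom f \<Longrightarrow> f (x * y) = f x * f y"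
  by (auto simp: rational_hom_def)

lemma rational_hom_0: "rational_hom f \<Longrightarrow> f 0 = 0"
  and rational_hom_1: "rational_hom f \<Longrightarrow> f 1 = 1"
  using rational_hom_rat[of f 0] rational_hom_rat[of f 1] by simp_all

lemma rational_hom_minus: "rational_hom f \<Longrightarrow> f (- x) = - f x"
  using rational_hom_add[of f x "- x"] rational_hom_0[of f] by (simp add: eq_neg_iff_add_eq_0 add.commute)

lemma rational_hom_eq_0_iff: "rational_hom f \<Longrightarrow> f x = 0 \<longleftrightarrow> x = 0"
  using rational_hom_mult[of f x "inverse x"] by (cases "x = 0") (auto simp: rational_hom_0 rational_hom_1)

lemma rational_hom_diff: "rational_hom f \<Longrightarrow> f (x - y) = f x - f y"
  using rational_hom_add[of f x "- y"] rational_hom_minus[of f y] by simp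

lemma rational_hom_inj: "rational_hom f \<Longrightarrow> f x = f y \<longleftrightarrow> x = y"
  using rational_hom_eq_0_iff[of f "x - y"] by (simp add: rational_hom_diff)

lemma rational_hom_inverse: "rational_hom f \<Longrightarrow> f (inverse x) = inverse (f x)"
  using rational_hom_mult[of f "inverse x" x]
  by (cases "x = 0") (auto simp: rational_hom_0 rational_hom_1 field_simps rational_hom_eq_0_iff)

lemma rational_hom_rpoly: "rational_hom f \<Longrightarrow> f (rpoly p x) = rpoly p (f x)"
  by (induction p) (simp_all add: rational_hom_0 rational_hom_add rational_hom_mult rational_hom_rat)

lemma rational_hom_id: "rational_hom (\<lambda>x. x)"
  by (simp add: rational_hom_def)

lemma rational_hom_comp: "rational_hom f \<Longrightarrow> rational_hom g \<Longrightarrow> rational_hom (\<lambda>x. f (g x))"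
  by (simp add: rational_hom_def)

text \<open>Together with \<open>generate_field_least\<close>, this reduces an identity between
  endomorphisms on a generated field to its generators.\<close>

lemma subfield_equalizer:
  fixes f g :: "'a :: {alg_closed_field, field_char_0} \<Rightarrow> 'a"
  assumes f: "rational_hom f" and g: "rational_hom g"
  shows "subfield {x. f x = g x} ambient"
  by (simp add: subfield_ambient_iff rational_hom_1[OF f] rational_hom_add[OF f] rational_hom_minus[OF f]
      rational_hom_mult[OF f] rational_hom_inverse[OF f] rational_hom_1[OF g] rational_hom_add[OF g]
      rational_hom_minus[OF g] rational_hom_mult[OF g] rational_hom_inverse[OF g])

lemma subfield_image:
  fixes f :: "'a :: {alg_closed_field, field_char_0} \<Rightarrow> 'a"
  assumes f: "rational_hom f" and S: "subfield S ambient"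
  shows "subfield (f ` S) ambient"
proof -
  note S' = S[unfolded subfield_ambient_iff]
  have "1 \<in> f ` S" using S' rational_hom_1[OF f] by (auto intro: rev_image_eqI)
  moreover have "- f a \<in> f ` S" if "a \<in> S" for a
    using that S' rational_hom_minus[OF f, of a] by (auto intro: rev_image_eqI[of "- a"])
  moreover have "f a + f b \<in> f ` S" if "a \<in> S" "b \<in> S" for a b
    using that S' rational_hom_add[OF f, of a b] by (auto intro: rev_image_eqI[of "a + b"])
  moreover have "f a * f b \<in> f ` S" if "a \<in> S" "b \<in> S" for a b
    using that S' rational_hom_mult[OF f, of a b] by (auto intro: rev_image_eqI[of "a * b"])
  moreover have "inverse (f a) \<in> f ` S" if "a \<in> S" "f a \<noteq> 0" for a
    using that S' rational_hom_inverse[OF f, of a] rational_hom_0[OF f]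
    by (auto intro: rev_image_eqI[of "inverse a"])
  ultimately show ?thesis unfolding subfield_ambient_iff by blast
qed

lemma subfield_vimage:
  fixes f :: "'a :: {alg_closed_field, field_char_0} \<Rightarrow> 'a"
  assumes f: "rational_hom f" and "subfield S ambient"
  shows "subfield (f -` S) ambient"
  using assms(2) by (simp add: subfield_ambient_iff rational_hom_1[OF f] rational_hom_add[OF f]
      rational_hom_minus[OF f] rational_hom_mult[OF f] rational_hom_inverse[OF f] rational_hom_eq_0_iff[OF f])

text \<open>A conjugate of an element of the generated field is its image under some
  \<open>rational_hom\<close>. Such a map preserves the generators and hence the field, which gives
  normality.\<close>

lemma galois_over_Q_generate:
  fixes S :: "'a :: {alg_closed_field, field_char_0} set"
  assumes alg: "\<forall>x :: 'a. algebraic x"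
    and S: "\<And>f. rational_hom f \<Longrightarrow> f ` S \<subseteq> S"
  shows "galois_over_Q (generate_field ambient S)" (is "galois_over_Q ?N")
  unfolding galois_over_Q_def
proof (intro conjI ballI allI impI)
  show "subfield ?N ambient" by (rule subfield_generate)
  show "algebraic x" for x :: 'a using alg by blast
  fix p and y :: 'a assume p: "Factorial_Ring.irreducible p" and "\<exists>x\<in>?N. rpoly p x = 0" and y: "rpoly p y = 0"
  then obtain x where x: "x \<in> ?N" "rpoly p x = 0" by blast
  obtain f where f: "rational_hom f" "f x = y" by (rule conjugate_rational_hom[OF alg p x(2) y])
  have "?N \<subseteq> f -` ?N"
    by (rule generate_field_least[OF subfield_vimage[OF f(1) subfield_generate]])
       (use S[OF f(1)] in \<open>auto intro: generate_field.incl\<close>)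
  then show "y \<in> ?N" using x f by blast
qed

section \<open>Cubic fields and their compositum\<close>

lemma cubic_field_image:
  fixes K :: "'a :: {alg_closed_field, field_char_0} set"
  assumes f: "rational_hom f" and "cubic_field K"
  shows "cubic_field (f ` K)"
proof -
  interpret field "ambient :: 'a ring" by (rule field_from_type_algebra)
  \<comment> \<open>As \<open>f\<close> fixes the rationals it is linear over them; being injective
    as well, it carries the inductive construction of a space of dimension \<open>n\<close> to
    another one.\<close>
  have ext: "f ` line_extension \<rat> v E = line_extension \<rat> (f v) (f ` E)" for v E
  proof -
    have fq: "f q = q" if "q \<in> \<rat>" for q
      using that f by (auto elim!: Rats_cases simp: rational_hom_rat)
    have mem: "line_extension \<rat> v E = {k * v + z | k z. k \<in> \<rat> \<and> z \<in> E}" for v E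
      using line_extension_mem_iff[of _ \<rat> v E] by auto
    have fk: "f (k * v + z) = k * f v + f z" if "k \<in> \<rat>" for k z
      by (simp add: rational_hom_add[OF f] rational_hom_mult[OF f] fq that)
    show ?thesis
    proof (intro equalityI subsetI)
      fix y assume "y \<in> f ` line_extension \<rat> v E"
      then obtain k z where "k \<in> \<rat>" "z \<in> E" "y = f (k * v + z)" unfolding mem by blast
      then show "y \<in> line_extension \<rat> (f v) (f ` E)" unfolding mem using fk by blast
    next
      fix y assume "y \<in> line_extension \<rat> (f v) (f ` E)"
      then obtain k z where kz: "k \<in> \<rat>" "z \<in> E" "y = k * f v + f z" unfolding mem by blast
      then have "y = f (k * v + z)" using fk by simp
      then show "y \<in> f ` line_extension \<rat> v E" unfolding mem using kz by blast
    qed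
  qed
  have "dimension n \<rat> (f ` E)" if "dimension n \<rat> E" for n E
    using that
  proof (induction n "\<rat> :: 'a set" E rule: dimension.induct)
    case zero_dim
    then show ?case using dimension.zero_dim[of \<rat>] by (simp add: rational_hom_0[OF f])
  next
    case (Suc_dim v E n)
    have "f v \<notin> f ` E" using Suc_dim by (auto simp: rational_hom_inj[OF f])
    then show ?case using Suc_dim dimension.Suc_dim[of "f v" "f ` E" n \<rat>] by (simp add: ext)
  qed
  then show ?thesis using assms by (auto simp: cubic_field_def subfield_image)
qed

text \<open>The four powers of \<open>x\<close> up to the cube are linearly dependent in a space of
  dimension 3, and the coefficients of a dependence form the polynomial.\<close>

lemma cubic_field_rpoly:
  fixes K :: "'a :: {alg_closed_field, field_char_0} set"
  assumes K: "cubic_field K" and x: "x \<in> K"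
  obtains p where "p \<noteq> 0" "degree p \<le> 3" "rpoly p x = 0"
proof -
  interpret field "ambient :: 'a ring" by (rule field_from_type_algebra)
  have sub: "subfield K ambient" and dim: "dimension 3 \<rat> K"
    using K by (auto simp: cubic_field_def)
  let ?U = "[1, x, x * x, x * x * x]"
  have U: "set ?U \<subseteq> K" using sub x by (auto simp: subfield_ambient_iff)
  have "dependent \<rat> ?U"
    using independent_length_le_dimension[OF subfield_Rats dim _ U] by fastforce
  then obtain Ks where Ks: "length Ks = length ?U" "combine Ks ?U = \<zero>\<^bsub>ambient\<^esub>" "set Ks \<subseteq> \<rat>" "set Ks \<noteq> {\<zero>\<^bsub>ambient\<^esub>}"
    using dependent_imp_non_trivial_combine[OF subfield_Rats _ \<open>dependent \<rat> ?U\<close>] by auto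
  obtain a b c d where abcd: "Ks = [a, b, c, d]"
    using Ks(1) by (auto simp: length_Suc_conv)
  obtain a' b' c' d' where r: "a = of_rat a'" "b = of_rat b'" "c = of_rat c'" "d = of_rat d'"
    using Ks(3) abcd by (auto elim!: Rats_cases)
  let ?p = "[:a', b', c', d':]"
  have "?p \<noteq> 0" using Ks(4) abcd r by auto
  moreover have "degree ?p \<le> 3" by simp
  moreover have "rpoly ?p x = 0" using Ks(2) by (simp add: abcd r algebra_simps)
  ultimately show ?thesis using that by blast
qed

text \<open>An injective self-map of a finite set is a permutation, and with at most three points
  all cases can be listed. Conceptually, the order of a permutation divides 6, and squares lie in
  the commutative group of even permutations.\<close>

lemma inj_on_le_3_laws:
  assumes R: "finite R" "card R \<le> 3"
    and f: "f ` R \<subseteq> R" "inj_on f R" and g: "g ` R \<subseteq> R" "inj_on g R" and r: "r \<in> R"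
  shows "f (f (f (f (f (f r))))) = r" "f (f (g (g r))) = g (g (f (f r)))"
proof -
  have "card R = 0 \<or> card R = 1 \<or> card R = 2 \<or> card R = 3" using R(2) by linarith
  then consider a where "R = {a}" | a b where "a \<noteq> b" "R = {a, b}"
    | a b c where "a \<noteq> b" "b \<noteq> c" "a \<noteq> c" "R = {a, b, c}"
    using R(1) r by (auto simp: card_1_singleton_iff card_2_iff card_3_iff)
  then have "f (f (f (f (f (f r))))) = r \<and> f (f (g (g r))) = g (g (f (f r)))"
  proof cases
    case 1
    then show ?thesis using f g r by auto
  next
    case 2
    have 1: "(h a = a \<and> h b = b) \<or> (h a = b \<and> h b = a)" if "h ` R \<subseteq> R" "inj_on h R" for h
      using that 2 by (auto simp: inj_on_def)
    show ?thesis using 1[OF f] 1[OF g] r 2 by auto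
  next
    case 3
    have 1: "(h a = a \<and> h b = b \<and> h c = c) \<or> (h a = a \<and> h b = c \<and> h c = b) \<or>
      (h a = b \<and> h b = a \<and> h c = c) \<or> (h a = b \<and> h b = c \<and> h c = a) \<or>
      (h a = c \<and> h b = a \<and> h c = b) \<or> (h a = c \<and> h b = b \<and> h c = a)"
      if "h ` R \<subseteq> R" "inj_on h R" for h
      using that 3 by (auto simp: inj_on_def)
    show ?thesis using 1[OF f] 1[OF g] r 3 by (elim disjE conjE) auto
  qed
  then show "f (f (f (f (f (f r))))) = r" "f (f (g (g r))) = g (g (f (f r)))" by auto
qed

lemma finite_rpoly_roots: "p \<noteq> 0 \<Longrightarrow> finite {y :: 'a :: field_char_0. rpoly p y = 0}"
  by (intro poly_roots_finite) (simp add: map_poly_eq_0_iff)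

text \<open>An element of a cubic field is a root of a rational polynomial with at most three roots,
  which both endomorphisms permute, so the laws hold there. Each law says that two endomorphisms
  agree, so it holds on a subfield, and this subfield contains the compositum.\<close>

lemma Q_three_infinity_laws:
  fixes f g :: "'a :: {alg_closed_field, field_char_0} \<Rightarrow> 'a"
  assumes f: "rational_hom f" and g: "rational_hom g" and x: "x \<in> Q_three_infinity"
  shows "f (f (f (f (f (f x))))) = x" "f (f (g (g x))) = g (g (f (f x)))"
proof -
  have cubic: "f (f (f (f (f (f x))))) = x \<and> f (f (g (g x))) = g (g (f (f x)))"
    if K: "cubic_field K" and x: "x \<in> K" for x K
  proof -
    obtain p where p: "p \<noteq> 0" "degree p \<le> 3" "rpoly p x = 0"
      using cubic_field_rpoly[OF K x] .
    let ?R = "{y :: 'a. rpoly p y = 0}"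
    have "card ?R \<le> degree (map_poly of_rat p :: 'a poly)"
      by (intro card_poly_roots_bound) (simp add: map_poly_eq_0_iff p)
    also have "degree (map_poly of_rat p :: 'a poly) = degree p"
      by (rule degree_map_poly) simp
    finally have "card ?R \<le> 3" using p(2) by simp
    have R: "h ` ?R \<subseteq> ?R" "inj_on h ?R" if "rational_hom h" for h
      using rational_hom_rpoly[OF that, of p] rational_hom_0[OF that] rational_hom_inj[OF that]
      by (auto simp: inj_on_def) metis
    have "x \<in> ?R" using p(3) by simp
    from inj_on_le_3_laws[OF finite_rpoly_roots[OF p(1)] \<open>card ?R \<le> 3\<close> R[OF f] R[OF g] this]
    show ?thesis by (rule conjI)
  qed
  have hf: "rational_hom (\<lambda>x. f (f (f (f (f (f x))))))" using f by (simp add: rational_hom_def)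
  have hfg: "rational_hom (\<lambda>x. f (f (g (g x))))" using f g by (simp add: rational_hom_def)
  have hgf: "rational_hom (\<lambda>x. g (g (f (f x))))" using f g by (simp add: rational_hom_def)
  have in_M: "x \<in> E" if "subfield E ambient" "\<Union> {K. cubic_field K} \<subseteq> E" for E
    using x generate_field_least[OF that] unfolding Q_three_infinity_def by (rule subsetD[rotated])
  have "x \<in> {x. f (f (f (f (f (f x))))) = x}"
    by (rule in_M[OF subfield_equalizer[OF hf rational_hom_id]]) (auto dest: cubic)
  then show "f (f (f (f (f (f x))))) = x" by simp
  have "x \<in> {x. f (f (g (g x))) = g (g (f (f x)))}"
    by (rule in_M[OF subfield_equalizer[OF hfg hgf]]) (auto dest: cubic)
  then show "f (f (g (g x))) = g (g (f (f x)))" by simp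
qed

text \<open>Conjugates of cubic fields are cubic, so the union of all cubic fields is a stable
  generating set.\<close>

lemma galois_over_Q_three_infinity:
  assumes "\<forall>x :: 'a :: {alg_closed_field, field_char_0}. algebraic x"
  shows "galois_over_Q (Q_three_infinity :: 'a set)"
  unfolding Q_three_infinity_def
proof (rule galois_over_Q_generate[OF assms])
  fix f :: "'a \<Rightarrow> 'a" assume f: "rational_hom f"
  show "f ` \<Union> {K. cubic_field K} \<subseteq> \<Union> {K. cubic_field K}"
    using cubic_field_image[OF f] by auto
qed

section \<open>Finite generation of the Galois closure\<close>

lemma number_field_generators:
  fixes L :: "'a :: {alg_closed_field, field_char_0} set"
  assumes "number_field L"
  obtains B where "finite B" "L \<subseteq> generate_field ambient B"
proof -
  interpret field "ambient :: 'a ring" by (rule field_from_type_algebra)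
  have "\<exists>B. finite B \<and> E \<subseteq> generate_field ambient B" if "dimension n \<rat> E" for n E
    using that
  proof (induction n "\<rat> :: 'a set" E rule: dimension.induct)
    case zero_dim
    have "0 \<in> generate_field ambient ({} :: 'a set)"
      using subfield_rat[OF subfield_generate, of 0] by simp
    then show ?case by (intro exI[of _ "{}"]) simp
  next
    case (Suc_dim v E n)
    then obtain B where B: "finite B" "E \<subseteq> generate_field ambient B" by blast
    \<comment> \<open>The generators are the vectors of a basis, collected one at a time along the
      induction on the dimension.\<close>
    let ?N = "generate_field ambient (insert v B)"
    note N = subfield_generate[of "insert v B", unfolded subfield_ambient_iff]
    have "generate_field ambient B \<subseteq> ?N"
      by (rule generate_field_least[OF subfield_generate]) (auto intro: generate_field.incl)
    moreover have "v \<in> ?N" by (auto intro: generate_field.incl)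
    moreover have "\<rat> \<subseteq> ?N" using subfield_rat[OF subfield_generate[of "insert v B"]] by (auto elim!: Rats_cases)
    ultimately have sub: "E \<subseteq> ?N" "v \<in> ?N" "\<rat> \<subseteq> ?N" using B(2) by blast+
    have "line_extension \<rat> v E \<subseteq> ?N"
    proof
      fix y assume "y \<in> line_extension \<rat> v E"
      then obtain k z where "k \<in> \<rat>" "z \<in> E" "y = k * v + z"
        using line_extension_mem_iff[of y \<rat> v E] by auto
      then show "y \<in> ?N" using sub N by blast
    qed
    then show ?case using B(1) by (intro exI[of _ "insert v B"]) simp
  qed
  moreover obtain n where "dimension n \<rat> L"
    using assms unfolding number_field_def finite_dimension_def by blast
  ultimately obtain B where "finite B" "L \<subseteq> generate_field ambient B" by blast
  then show ?thesis by (rule that)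
qed

text \<open>The set \<open>R\<close> consists of all conjugates of finitely many generators. It is
  stable under endomorphisms, so it generates a Galois field containing \<open>L\<close>, and this
  field is among those intersected in the Galois closure.\<close>

lemma galois_closure_finitely_generated:
  fixes L :: "'a :: {alg_closed_field, field_char_0} set"
  assumes alg: "\<forall>x :: 'a. algebraic x" and "number_field L"
  obtains R where "finite R" "galois_closure L \<subseteq> generate_field ambient R"
    "\<And>f. rational_hom f \<Longrightarrow> f ` R \<subseteq> R"
proof -
  obtain B where B: "finite B" "L \<subseteq> generate_field ambient B"
    using number_field_generators[OF assms(2)] .
  define conjugates where "conjugates b = {f b | f. rational_hom f}" for b :: 'a
  have "finite (conjugates b)" for b
  proof -
    have "algebraic b" using alg by simp
    then obtain p where p: "p \<noteq> 0" "rpoly p b = 0" by (rule algebraic_rpoly)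
    \<comment> \<open>Every conjugate is a root of the same nonzero rational polynomial, so there
      are finitely many.\<close>
    have "conjugates b \<subseteq> {y. rpoly p y = 0}"
    proof
      fix y assume "y \<in> conjugates b"
      then obtain f where f: "rational_hom f" "y = f b" by (auto simp: conjugates_def)
      show "y \<in> {y. rpoly p y = 0}"
        using rational_hom_rpoly[OF f(1), of p b] p(2) f(2) rational_hom_0[OF f(1)] by simp
    qed
    then show ?thesis by (rule finite_subset[OF _ finite_rpoly_roots[OF p(1)]])
  qed
  then have fin: "finite (\<Union>b\<in>B. conjugates b)" using B(1) by simp
  have stable: "f ` (\<Union>b\<in>B. conjugates b) \<subseteq> (\<Union>b\<in>B. conjugates b)" if f: "rational_hom f" for f
  proof clarify
    fix b y assume "b \<in> B" "y \<in> conjugates b"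
    then obtain g where "rational_hom g" "y = g b" unfolding conjugates_def by blast
    then have "\<exists>h. f y = h b \<and> rational_hom h"
      using rational_hom_comp[OF f, of g] by (intro exI[of _ "\<lambda>x. f (g x)"]) simp
    then have "f y \<in> conjugates b" by (simp add: conjugates_def)
    then show "f y \<in> (\<Union>b\<in>B. conjugates b)" using \<open>b \<in> B\<close> by blast
  qed
  have "b \<in> conjugates b" for b
    unfolding conjugates_def using rational_hom_id by (intro CollectI exI[of _ "\<lambda>x. x"]) simp
  then have "B \<subseteq> generate_field ambient (\<Union>b\<in>B. conjugates b)" by (auto intro: generate_field.incl)
  then have "generate_field ambient B \<subseteq> generate_field ambient (\<Union>b\<in>B. conjugates b)"
    by (rule generate_field_least[OF subfield_generate])
  then have "galois_closure L \<subseteq> generate_field ambient (\<Union>b\<in>B. conjugates b)"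
    using galois_over_Q_generate[OF alg stable] B(2) unfolding galois_closure_def
    by (intro Inter_lower) simp
  from that[OF fin this stable] show ?thesis .
qed

section \<open>The Galois group: group structure, laws and finiteness\<close>

lemma carrier_galois_group:
  "\<sigma> \<in> carrier (galois_group N) \<longleftrightarrow> \<sigma> \<in> Bij N \<and> (\<forall>x\<in>N. \<forall>y\<in>N. \<sigma> (x + y) = \<sigma> x + \<sigma> y \<and> \<sigma> (x * y) = \<sigma> x * \<sigma> y)
     \<and> (\<forall>q\<in>\<rat>. \<sigma> q = q)"
proof -
  have "\<sigma> 1 = 1" if "\<forall>q\<in>\<rat>. \<sigma> q = q" using that Rats_1 by blast
  then show ?thesis
    using Bij_imp_funcset[of \<sigma> N] by (auto simp: galois_group_def ring_hom_def)
qed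

lemma mult_galois_group:
  "\<sigma> \<in> carrier (galois_group N) \<Longrightarrow> \<tau> \<in> carrier (galois_group N) \<Longrightarrow> \<sigma> \<otimes>\<^bsub>galois_group N\<^esub> \<tau> = compose N \<sigma> \<tau>"
  by (auto simp: carrier_galois_group) (simp add: galois_group_def BijGroup_def)

lemma one_galois_group: "\<one>\<^bsub>galois_group N\<^esub> = (\<lambda>x\<in>N. x)"
  by (simp add: galois_group_def BijGroup_def)

lemma group_galois_group:
  assumes N: "subfield (N :: 'a :: {alg_closed_field, field_char_0} set) ambient"
  shows "group (galois_group N)"
proof -
  have N1: "x + y \<in> N" "x * y \<in> N" if "x \<in> N" "y \<in> N" for x y
    using N that unfolding subfield_ambient_iff by blast+
  have rat: "q \<in> N" if "q \<in> \<rat>" for q using that subfield_rat[OF N] by (auto elim!: Rats_cases)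
  let ?C = "carrier (galois_group N)"
  have CB: "\<sigma> \<in> Bij N" if "\<sigma> \<in> ?C" for \<sigma> using that by (simp add: carrier_galois_group)
  have hom: "\<sigma> (x + y) = \<sigma> x + \<sigma> y" "\<sigma> (x * y) = \<sigma> x * \<sigma> y"
    if "\<sigma> \<in> ?C" "x \<in> N" "y \<in> N" for \<sigma> x y
    using that by (simp_all add: carrier_galois_group)
  have fixq: "\<sigma> q = q" if "\<sigma> \<in> ?C" "q \<in> \<rat>" for \<sigma> q
    using that by (simp add: carrier_galois_group)
  have "subgroup ?C (BijGroup N)"
  proof (rule group.subgroupI[OF group_BijGroup])
    show "?C \<subseteq> carrier (BijGroup N)" using CB by (auto simp: BijGroup_def)
    have "(\<lambda>x\<in>N. x) \<in> ?C" using N1 rat by (simp add: carrier_galois_group id_Bij)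
    then show "?C \<noteq> {}" by blast
  next
    fix \<sigma> assume s: "\<sigma> \<in> ?C"
    note b = CB[OF s]
    let ?\<tau> = "inv_into N \<sigma>"
    have st: "\<sigma> (?\<tau> x) = x" "?\<tau> x \<in> N" if "x \<in> N" for x
      using b that by (auto simp: Bij_def bij_betw_def f_inv_into_f inv_into_into)
    have ts: "?\<tau> (\<sigma> x) = x" if "x \<in> N" for x
      using b that by (auto simp: Bij_def bij_betw_def)
    \<comment> \<open>Additivity and multiplicativity of the inverse follow by applying it to the
      value of \<open>\<sigma>\<close> at the sum or product of the preimages.\<close>
    have "?\<tau> (x + y) = ?\<tau> x + ?\<tau> y" "?\<tau> (x * y) = ?\<tau> x * ?\<tau> y" if "x \<in> N" "y \<in> N" for x y
      using ts[OF N1(1)[OF st(2)[OF that(1)] st(2)[OF that(2)]]]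
        ts[OF N1(2)[OF st(2)[OF that(1)] st(2)[OF that(2)]]]
        hom[OF s st(2)[OF that(1)] st(2)[OF that(2)]] st(1)[OF that(1)] st(1)[OF that(2)] by simp_all
    moreover have "?\<tau> q = q" if "q \<in> \<rat>" for q
      using ts[OF rat[OF that]] fixq[OF s that] by simp
    ultimately have "restrict ?\<tau> N \<in> ?C"
      using restrict_inv_into_Bij[OF b] N1 rat by (simp add: carrier_galois_group)
    then show "inv\<^bsub>BijGroup N\<^esub> \<sigma> \<in> ?C" by (simp add: inv_BijGroup[OF b])
  next
    fix \<sigma> \<tau> assume s: "\<sigma> \<in> ?C" and t: "\<tau> \<in> ?C"
    note b = CB[OF s] CB[OF t]
    have tN: "\<tau> x \<in> N" if "x \<in> N" for x using Bij_imp_funcset[OF b(2)] that by blast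
    have "compose N \<sigma> \<tau> \<in> ?C"
      unfolding carrier_galois_group
      using compose_Bij[OF b] by (simp add: compose_eq N1 rat tN hom[OF s] hom[OF t] fixq[OF s] fixq[OF t])
    then show "\<sigma> \<otimes>\<^bsub>BijGroup N\<^esub> \<tau> \<in> ?C" using b by (simp add: BijGroup_def)
  qed
  then have "group (BijGroup N\<lparr>carrier := ?C\<rparr>)"
    by (rule subgroup.subgroup_is_group[OF _ group_BijGroup])
  then show ?thesis by (simp add: galois_group_def)
qed

text \<open>The graph of an automorphism of \<open>N\<close> is a partial homomorphism. The lift
  makes statements about endomorphisms of the closure available for the Galois group of a
  subfield.\<close>

lemma galois_group_lift:
  fixes N :: "'a :: {alg_closed_field, field_char_0} set"
  assumes alg: "\<forall>x :: 'a. algebraic x" and N: "subfield N ambient" and s: "\<sigma> \<in> carrier (galois_group N)"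
  shows "\<exists>f. rational_hom f \<and> (\<forall>x\<in>N. f x = \<sigma> x)"
proof -
  note Ns = N[unfolded subfield_ambient_iff] and s' = s[unfolded carrier_galois_group]
  let ?G = "{(x, \<sigma> x) | x. x \<in> N}"
  have "partial_hom ?G"
    unfolding partial_hom_def
  proof (intro conjI allI impI)
    show "(of_rat q, of_rat q) \<in> ?G" for q
    proof -
      have "\<sigma> (of_rat q) = of_rat q" using s' by simp
      then show ?thesis using subfield_rat[OF N, of q] by force
    qed
    fix x x' y y' assume "(x, x') \<in> ?G" "(y, y') \<in> ?G"
    then have "x \<in> N" "y \<in> N" "x' = \<sigma> x" "y' = \<sigma> y" by auto
    then show "(x + y, x' + y') \<in> ?G" "(x * y, x' * y') \<in> ?G" using s' Ns by simp_all
  next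
    show "y = 0" if "(0, y) \<in> ?G" for y using that s' by simp
  qed
  then obtain f where f: "rational_hom f" "\<And>x y. (x, y) \<in> ?G \<Longrightarrow> f x = y"
    using partial_hom_extends_to_rational_hom[OF alg] by blast
  then show ?thesis by (intro exI[of _ f]) auto
qed

lemma galois_group_laws:
  fixes N :: "'a :: {alg_closed_field, field_char_0} set"
  assumes alg: "\<forall>x :: 'a. algebraic x" and N: "subfield N ambient" "N \<subseteq> Q_three_infinity"
    and s: "\<sigma> \<in> carrier (galois_group N)" and t: "\<tau> \<in> carrier (galois_group N)"
  shows "\<sigma> [^]\<^bsub>galois_group N\<^esub> (6 :: nat) = \<one>\<^bsub>galois_group N\<^esub>"
    "(\<sigma> \<otimes>\<^bsub>galois_group N\<^esub> \<sigma>) \<otimes>\<^bsub>galois_group N\<^esub> (\<tau> \<otimes>\<^bsub>galois_group N\<^esub> \<tau>) =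
     (\<tau> \<otimes>\<^bsub>galois_group N\<^esub> \<tau>) \<otimes>\<^bsub>galois_group N\<^esub> (\<sigma> \<otimes>\<^bsub>galois_group N\<^esub> \<sigma>)"
proof -
  interpret group "galois_group N" by (rule group_galois_group[OF N(1)])
  obtain f where f: "rational_hom f" "\<And>x. x \<in> N \<Longrightarrow> f x = \<sigma> x"
    using galois_group_lift[OF alg N(1) s] by blast
  obtain g where g: "rational_hom g" "\<And>x. x \<in> N \<Longrightarrow> g x = \<tau> x"
    using galois_group_lift[OF alg N(1) t] by blast
  have sN: "\<sigma> x \<in> N" "\<tau> x \<in> N" if "x \<in> N" for x
    using s t that Bij_imp_funcset by (fastforce simp: carrier_galois_group)+
  have law: "\<sigma> (\<sigma> (\<sigma> (\<sigma> (\<sigma> (\<sigma> x))))) = x" "\<sigma> (\<sigma> (\<tau> (\<tau> x))) = \<tau> (\<tau> (\<sigma> (\<sigma> x)))" if "x \<in> N" for x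
    using Q_three_infinity_laws[OF f(1) g(1), of x] that N(2) f(2) g(2) sN by auto
  \<comment> \<open>Composition restricted to \<open>N\<close> preserves the convention that
    automorphisms are undefined outside \<open>N\<close>, so equality of functions reduces to
    equality on \<open>N\<close>.\<close>
  have "\<sigma> [^]\<^bsub>galois_group N\<^esub> (6 :: nat) = compose N (compose N (compose N (compose N (compose N \<sigma> \<sigma>) \<sigma>) \<sigma>) \<sigma>) \<sigma>"
    using s m_closed by (simp add: numeral_eq_Suc mult_galois_group[symmetric])
  also have "\<dots> = (\<lambda>x\<in>N. x)" using law sN by (auto simp: compose_def fun_eq_iff restrict_def)
  finally show "\<sigma> [^]\<^bsub>galois_group N\<^esub> (6 :: nat) = \<one>\<^bsub>galois_group N\<^esub>" by (simp add: one_galois_group)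
  show "(\<sigma> \<otimes>\<^bsub>galois_group N\<^esub> \<sigma>) \<otimes>\<^bsub>galois_group N\<^esub> (\<tau> \<otimes>\<^bsub>galois_group N\<^esub> \<tau>) =
     (\<tau> \<otimes>\<^bsub>galois_group N\<^esub> \<tau>) \<otimes>\<^bsub>galois_group N\<^esub> (\<sigma> \<otimes>\<^bsub>galois_group N\<^esub> \<sigma>)"
    using law sN s t m_closed[OF s s] m_closed[OF t t]
    by (simp add: mult_galois_group) (auto simp: compose_def fun_eq_iff restrict_def)
qed

text \<open>Lifts that agree on \<open>R\<close> agree on the field it generates, hence on
  \<open>N\<close>. An automorphism is therefore determined by the self-map of the finite set
  \<open>R\<close> that its chosen lift induces.\<close>

lemma finite_galois_group:
  fixes N :: "'a :: {alg_closed_field, field_char_0} set"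
  assumes alg: "\<forall>x :: 'a. algebraic x" and N: "subfield N ambient"
    and R: "finite R" "N \<subseteq> generate_field ambient R" "\<And>f. rational_hom f \<Longrightarrow> f ` R \<subseteq> R"
  shows "finite (carrier (galois_group N))"
proof -
  let ?C = "carrier (galois_group N)"
  obtain F where F: "\<And>\<sigma>. \<sigma> \<in> ?C \<Longrightarrow> rational_hom (F \<sigma>)" "\<And>\<sigma> x. \<sigma> \<in> ?C \<Longrightarrow> x \<in> N \<Longrightarrow> F \<sigma> x = \<sigma> x"
    using galois_group_lift[OF alg N] by metis
  have "inj_on (\<lambda>\<sigma>. restrict (F \<sigma>) R) ?C"
  proof (rule inj_onI)
    fix \<sigma> \<tau> assume s: "\<sigma> \<in> ?C" and t: "\<tau> \<in> ?C" and eq: "restrict (F \<sigma>) R = restrict (F \<tau>) R"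
    have "F \<sigma> x = F \<tau> x" if "x \<in> R" for x using fun_cong[OF eq, of x] that by simp
    then have "R \<subseteq> {x. F \<sigma> x = F \<tau> x}" by auto
    then have "generate_field ambient R \<subseteq> {x. F \<sigma> x = F \<tau> x}"
      by (rule generate_field_least[OF subfield_equalizer[OF F(1)[OF s] F(1)[OF t]]])
    then have "\<sigma> x = \<tau> x" if "x \<in> N" for x using that F(2)[OF s that] F(2)[OF t that] R(2) by auto
    then show "\<sigma> = \<tau>"
      using s t by (intro extensionalityI[of _ N]) (auto simp: carrier_galois_group Bij_imp_extensional)
  qed
  moreover have "(\<lambda>\<sigma>. restrict (F \<sigma>) R) ` ?C \<subseteq> R \<rightarrow>\<^sub>E R"
  proof clarify
    fix \<sigma> assume "\<sigma> \<in> ?C"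
    then have "F \<sigma> ` R \<subseteq> R" by (intro R(3) F(1))
    then show "restrict (F \<sigma>) R \<in> R \<rightarrow>\<^sub>E R" by auto
  qed
  moreover have "finite (R \<rightarrow>\<^sub>E R)" using R(1) by (intro finite_PiE) auto
  ultimately show ?thesis by (rule inj_on_finite)
qed

section \<open>Finite groups satisfying the laws of $S_3$\<close>

locale S3_laws = group G for G (structure) +
  assumes fin: "finite (carrier G)"
    and exponent_6: "x \<in> carrier G \<Longrightarrow> x [^] (6 :: nat) = \<one>"
    and squares_commute: "x \<in> carrier G \<Longrightarrow> y \<in> carrier G \<Longrightarrow> (x \<otimes> x) \<otimes> (y \<otimes> y) = (y \<otimes> y) \<otimes> (x \<otimes> x)"
begin

definition three_torsion :: "'a set"
  where "three_torsion = {x \<in> carrier G. x \<otimes> (x \<otimes> x) = \<one>}"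

definition conjg :: "'a \<Rightarrow> 'a \<Rightarrow> 'a"
  where "conjg x a = x \<otimes> a \<otimes> inv x"

lemma inv_cancel [simp]:
  assumes "x \<in> carrier G" "y \<in> carrier G"
  shows "inv x \<otimes> (x \<otimes> y) = y" "x \<otimes> (inv x \<otimes> y) = y"
  using assms m_assoc[of "inv x" x y] m_assoc[of x "inv x" y] by simp_all

lemma three_torsion_I: "x \<in> carrier G \<Longrightarrow> x \<otimes> (x \<otimes> x) = \<one> \<Longrightarrow> x \<in> three_torsion"
  and three_torsion_cube: "a \<in> three_torsion \<Longrightarrow> a \<otimes> (a \<otimes> a) = \<one>"
  and three_torsion_carrier [simp]: "a \<in> three_torsion \<Longrightarrow> a \<in> carrier G"
  by (simp_all add: three_torsion_def)

lemma three_torsion_inv: "a \<in> three_torsion \<Longrightarrow> inv a = a \<otimes> a"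
  by (rule inv_equality) (simp_all add: three_torsion_cube m_assoc)

text \<open>An element with trivial cube is its own fourth power, hence a square, and squares
  commute.\<close>

lemma three_torsion_commute:
  assumes "a \<in> three_torsion" "b \<in> three_torsion"
  shows "a \<otimes> b = b \<otimes> a"
proof -
  have "(c \<otimes> c) \<otimes> (c \<otimes> c) = c" if "c \<in> three_torsion" for c
    using three_torsion_cube[OF that] three_torsion_carrier[OF that] by (simp add: m_assoc)
  then show ?thesis using squares_commute[of "a \<otimes> a" "b \<otimes> b"] assms by simp
qed

lemma three_torsion_subgroup: "subgroup three_torsion G"
proof (rule subgroupI)
  show "three_torsion \<subseteq> carrier G" by auto
  have "\<one> \<in> three_torsion" by (rule three_torsion_I) simp_all
  then show "three_torsion \<noteq> {}" by blast
next
  fix a assume a: "a \<in> three_torsion"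
  have "(a \<otimes> a) \<otimes> ((a \<otimes> a) \<otimes> (a \<otimes> a)) = (a \<otimes> (a \<otimes> a)) \<otimes> (a \<otimes> (a \<otimes> a))"
    using three_torsion_carrier[OF a] by (simp add: m_assoc)
  then have "a \<otimes> a \<in> three_torsion" by (intro three_torsion_I) (simp_all add: a three_torsion_cube)
  then show "inv a \<in> three_torsion" by (simp add: three_torsion_inv[OF a])
next
  fix a b assume ab: "a \<in> three_torsion" "b \<in> three_torsion"
  have left: "b \<otimes> (a \<otimes> z) = a \<otimes> (b \<otimes> z)" if "z \<in> carrier G" for z
    using ab that by (simp add: m_assoc[symmetric] three_torsion_commute[OF ab])
  have "(a \<otimes> b) \<otimes> ((a \<otimes> b) \<otimes> (a \<otimes> b)) = (a \<otimes> (a \<otimes> a)) \<otimes> (b \<otimes> (b \<otimes> b))"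
    using ab by (simp add: m_assoc left)
  then show "a \<otimes> b \<in> three_torsion" by (intro three_torsion_I) (simp_all add: ab three_torsion_cube)
qed

lemmas three_torsion_one [simp] = subgroup.one_closed[OF three_torsion_subgroup]
  and three_torsion_mult [simp] = subgroup.m_closed[OF three_torsion_subgroup]
  and three_torsion_inv_closed [simp] = subgroup.m_inv_closed[OF three_torsion_subgroup]

lemma square_in_three_torsion: "x \<in> carrier G \<Longrightarrow> x \<otimes> x \<in> three_torsion"
  using exponent_6[of x] by (intro three_torsion_I) (simp_all add: numeral_eq_Suc m_assoc)

lemma conjg_closed [simp]: "x \<in> carrier G \<Longrightarrow> a \<in> carrier G \<Longrightarrow> conjg x a \<in> carrier G"
  by (simp add: conjg_def)

lemma conjg_mult: "x \<in> carrier G \<Longrightarrow> a \<in> carrier G \<Longrightarrow> b \<in> carrier G \<Longrightarrow> conjg x (a \<otimes> b) = conjg x a \<otimes> conjg x b"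
  by (simp add: conjg_def m_assoc)

lemma conjg_one [simp]: "x \<in> carrier G \<Longrightarrow> conjg x \<one> = \<one>"
  by (simp add: conjg_def)

lemma conjg_inv: "x \<in> carrier G \<Longrightarrow> a \<in> carrier G \<Longrightarrow> conjg x (inv a) = inv (conjg x a)"
  by (simp add: conjg_def m_assoc inv_mult_group)

lemma conjg_conj: "x \<in> carrier G \<Longrightarrow> y \<in> carrier G \<Longrightarrow> a \<in> carrier G \<Longrightarrow> conjg x (conjg y a) = conjg (x \<otimes> y) a"
  by (simp add: conjg_def m_assoc inv_mult_group)

lemma conjg_fix_iff: "x \<in> carrier G \<Longrightarrow> a \<in> carrier G \<Longrightarrow> conjg x a = a \<longleftrightarrow> x \<otimes> a = a \<otimes> x"
  unfolding conjg_def by (metis inv_solve_right m_closed)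

lemma conjg_three_torsion [simp]: "x \<in> carrier G \<Longrightarrow> a \<in> three_torsion \<Longrightarrow> conjg x a \<in> three_torsion"
  using conjg_mult[of x a "a \<otimes> a"] conjg_mult[of x a a] three_torsion_cube[of a] by (intro three_torsion_I) simp_all

lemma conjg_three_torsion_trivial: "c \<in> three_torsion \<Longrightarrow> a \<in> three_torsion \<Longrightarrow> conjg c a = a"
  by (simp add: conjg_fix_iff three_torsion_commute)

lemma normal_conjgI:
  assumes "subgroup H G" "\<And>x h. x \<in> carrier G \<Longrightarrow> h \<in> H \<Longrightarrow> conjg x h \<in> H"
  shows "H \<lhd> G"
  using assms by (simp add: normal_inv_iff conjg_def)

lemma three_torsion_normal: "three_torsion \<lhd> G"
  by (rule normal_conjgI[OF three_torsion_subgroup]) simp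

lemma commutator_in_three_torsion:
  assumes x: "x \<in> carrier G" and y: "y \<in> carrier G"
  obtains c where "c \<in> three_torsion" "x \<otimes> y = c \<otimes> (y \<otimes> x)"
proof -
  \<comment> \<open>$xyx^{-1}y^{-1} = (xy)^2 \cdot y^{-1}x^{-2}y \cdot y^{-2}$ is a product of conjugates of squares\<close>
  let ?c = "((x \<otimes> y) \<otimes> (x \<otimes> y)) \<otimes> (conjg (inv y) (inv x \<otimes> inv x) \<otimes> (inv y \<otimes> inv y))"
  have "?c \<in> three_torsion" using square_in_three_torsion x y by simp
  moreover have "x \<otimes> y = ?c \<otimes> (y \<otimes> x)" using x y by (simp add: conjg_def m_assoc)
  ultimately show ?thesis using that by blast
qed

text \<open>The products in the two orders differ by an element of the three-torsion, which acts
  trivially on this abelian subgroup. Conjugation thus acts on it through an abelian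
  quotient.\<close>

lemma conjg_three_torsion_swap:
  assumes "x \<in> carrier G" "y \<in> carrier G" "a \<in> three_torsion"
  shows "conjg x (conjg y a) = conjg y (conjg x a)"
proof -
  obtain c where c: "c \<in> three_torsion" "x \<otimes> y = c \<otimes> (y \<otimes> x)" using commutator_in_three_torsion assms by blast
  have "conjg x (conjg y a) = conjg c (conjg y (conjg x a))" using assms c by (simp add: conjg_conj)
  then show ?thesis using assms c by (simp add: conjg_three_torsion_trivial)
qed

text \<open>The square of \<open>x\<close> lies in the abelian three-torsion and so acts trivially
  on it.\<close>

lemma conjg_three_torsion_involution: "x \<in> carrier G \<Longrightarrow> a \<in> three_torsion \<Longrightarrow> conjg x (conjg x a) = a"
  by (simp add: conjg_conj conjg_three_torsion_trivial square_in_three_torsion)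

lemma three_torsion_eq_one: "a \<in> three_torsion \<Longrightarrow> a \<otimes> a = \<one> \<Longrightarrow> a = \<one>"
  using three_torsion_cube[of a] by simp

end

section \<open>Groups with a nontrivial element lying in every nontrivial normal subgroup\<close>

locale monolithic_S3_laws = S3_laws +
  fixes g
  assumes g: "g \<in> carrier G" "g \<noteq> \<one>"
    and monolith: "H \<lhd> G \<Longrightarrow> H \<noteq> {\<one>} \<Longrightarrow> g \<in> H"
begin

lemma conjg_dichotomy:
  assumes x: "x \<in> carrier G"
  shows "(\<forall>a\<in>three_torsion. conjg x a = a) \<or> (\<forall>a\<in>three_torsion. conjg x a = inv a)"
proof -
  \<comment> \<open>The eigenspaces of conjugation by \<open>x\<close> for the eigenvalues 1 and -1.
    They are normal because conjugations commute on the three-torsion.\<close>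
  let ?P = "{a \<in> three_torsion. conjg x a = a}" and ?M = "{a \<in> three_torsion. conjg x a = inv a}"
  have P: "?P \<lhd> G"
  proof (rule normal_conjgI)
    show "subgroup ?P G"
      by (rule subgroupI) (use x in \<open>auto simp: conjg_inv conjg_mult intro!: exI[of _ \<one>]\<close>)
    show "conjg y h \<in> ?P" if "y \<in> carrier G" "h \<in> ?P" for y h
      using that x conjg_three_torsion_swap[of x y h] by simp
  qed
  have M: "?M \<lhd> G"
  proof (rule normal_conjgI)
    show "subgroup ?M G"
    proof (rule subgroupI)
      show "?M \<noteq> {}" using x by (auto intro!: exI[of _ \<one>])
      show "a \<otimes> b \<in> ?M" if "a \<in> ?M" "b \<in> ?M" for a b
        using that x three_torsion_commute[of a b] by (simp add: conjg_mult inv_mult_group) (metis three_torsion_commute three_torsion_inv_closed)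
    qed (use x in \<open>auto simp: conjg_inv\<close>)
    show "conjg y h \<in> ?M" if "y \<in> carrier G" "h \<in> ?M" for y h
      using that x conjg_three_torsion_swap[of x y h] by (simp add: conjg_inv)
  qed
  \<comment> \<open>An element of both eigenspaces equals its inverse while having trivial cube, so
    it is the identity. Hence one eigenspace misses \<open>g\<close> and is trivial.\<close>
  have "\<not> (g \<in> ?P \<and> g \<in> ?M)"
  proof
    assume "g \<in> ?P \<and> g \<in> ?M"
    then have "g \<in> three_torsion" "inv g = g" by auto
    then have "g \<otimes> g = \<one>" using g(1) by (metis r_inv)
    then show False using three_torsion_eq_one \<open>g \<in> three_torsion\<close> g(2) by blast
  qed
  then consider "?P = {\<one>}" | "?M = {\<one>}" using monolith[OF P] monolith[OF M] by blast
  then show ?thesis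
  proof cases
    case 1
    have "conjg x a = inv a" if a: "a \<in> three_torsion" for a
    proof -
      \<comment> \<open>The product of \<open>a\<close> with its image under the involution is
        fixed, so it lies in the trivial eigenspace \<open>?P\<close>.\<close>
      have "conjg x (a \<otimes> conjg x a) = a \<otimes> conjg x a"
        using x a three_torsion_commute[of a "conjg x a"] by (simp add: conjg_mult conjg_three_torsion_involution)
      then have "a \<otimes> conjg x a \<in> ?P" using x a by simp
      then have "a \<otimes> conjg x a = \<one>" using 1 by blast
      then have "conjg x a \<otimes> a = \<one>" using x a three_torsion_commute[of a "conjg x a"] by simp
      then have "inv a = conjg x a" using x a by (intro inv_equality) simp_all
      then show ?thesis by simp
    qed
    then show ?thesis by blast
  next
    case 2
    have "conjg x a = a" if a: "a \<in> three_torsion" for a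
    proof -
      \<comment> \<open>The quotient of \<open>a\<close> by its image is inverted, so it lies in the
        trivial eigenspace \<open>?M\<close>.\<close>
      have "conjg x (a \<otimes> inv (conjg x a)) = inv (a \<otimes> inv (conjg x a))"
        using x a by (simp add: conjg_mult conjg_inv conjg_three_torsion_involution inv_mult_group)
      then have "a \<otimes> inv (conjg x a) \<in> ?M" using x a by simp
      then have "a \<otimes> inv (conjg x a) = \<one>" using 2 by blast
      then show ?thesis using x a by (metis three_torsion_carrier conjg_closed inv_closed inv_equality inv_inv)
    qed
    then show ?thesis by blast
  qed
qed

text \<open>By the dichotomy every cyclic subgroup of the three-torsion is normal, so each
  nontrivial one contains \<open>g\<close>. All of them thus coincide with the subgroup generated by
  \<open>g\<close>.\<close>

lemma three_torsion_subset:
  assumes "three_torsion \<noteq> {\<one>}"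
  shows "three_torsion \<subseteq> {\<one>, g, g \<otimes> g}" "g \<in> three_torsion"
proof -
  show "g \<in> three_torsion" using monolith[OF three_torsion_normal] assms by blast
  show "three_torsion \<subseteq> {\<one>, g, g \<otimes> g}"
  proof
    fix a assume a: "a \<in> three_torsion"
    have a4: "(a \<otimes> a) \<otimes> (a \<otimes> a) = a" using three_torsion_cube[OF a] a by (simp add: m_assoc)
    have c3: "a \<otimes> (a \<otimes> a) = \<one>" "(a \<otimes> a) \<otimes> a = \<one>" using three_torsion_cube[OF a] a by (simp_all add: m_assoc)
    let ?N = "{\<one>, a, a \<otimes> a}"
    have inv_aa: "inv (a \<otimes> a) = a" using a c3 by (intro inv_equality) simp_all
    have inv_N: "inv h \<in> ?N" if "h \<in> ?N" for h
      using that by (elim insertE emptyE) (simp_all add: three_torsion_inv[OF a] inv_aa)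
    have "?N \<lhd> G"
    proof (rule normal_conjgI)
      show "subgroup ?N G"
      proof (rule subgroupI)
        show "b \<otimes> c \<in> ?N" if "b \<in> ?N" "c \<in> ?N" for b c
          using that by (elim insertE emptyE) (simp_all add: a a4 c3)
        show "inv b \<in> ?N" if "b \<in> ?N" for b using that by (rule inv_N)
      qed (simp_all add: a)
      show "conjg y h \<in> ?N" if "y \<in> carrier G" "h \<in> ?N" for y h
      proof -
        have "h \<in> three_torsion" using that(2) by (elim insertE emptyE) (simp_all add: a)
        then have "conjg y h = h \<or> conjg y h = inv h" using conjg_dichotomy[OF that(1)] by blast
        then show ?thesis using that(2) inv_N[OF that(2)] by (elim disjE) simp_all
      qed
    qed
    then have "g \<in> ?N" if "a \<noteq> \<one>" using monolith[of ?N] that by blast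
    then consider "a = \<one>" | "g = a" | "g = a \<otimes> a" using g(2) by blast
    then show "a \<in> {\<one>, g, g \<otimes> g}" by cases (simp_all add: a4)
  qed
qed

lemma centralizer_three_torsion:
  assumes nontrivial: "three_torsion \<noteq> {\<one>}" and x: "x \<in> carrier G" "conjg x g = g"
  shows "x \<in> three_torsion"
proof -
  note gA = three_torsion_subset(2)[OF nontrivial]
  \<comment> \<open>The three-torsion consists of powers of \<open>g\<close>, so centralizing
    \<open>g\<close> means centralizing all of it.\<close>
  have fixA: "conjg y a = a" if "y \<in> carrier G" "conjg y g = g" "a \<in> three_torsion" for y a
    using three_torsion_subset(1)[OF nontrivial] that g(1) by (auto simp: conjg_mult)
  \<comment> \<open>Commutators of elements of \<open>?E\<close> lie in the three-torsion and square to one, so \<open>?E\<close> is an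
    abelian normal subgroup. It does not contain \<open>g\<close>, so it is trivial.\<close>
  let ?E = "{y \<in> carrier G. y \<otimes> y = \<one> \<and> conjg y g = g}"
  have "?E \<lhd> G"
  proof (rule normal_conjgI)
    show "subgroup ?E G"
    proof (rule subgroupI)
      show "?E \<noteq> {}" using g(1) by (auto intro!: exI[of _ \<one>] simp: conjg_def)
      show "inv y \<in> ?E" if "y \<in> ?E" for y
        using that inv_equality[of y y] by auto
      fix y z assume "y \<in> ?E" "z \<in> ?E"
      then have y: "y \<in> carrier G" "y \<otimes> y = \<one>" "conjg y g = g" and z: "z \<in> carrier G" "z \<otimes> z = \<one>" "conjg z g = g"
        by auto
      obtain c where c: "c \<in> three_torsion" "y \<otimes> z = c \<otimes> (z \<otimes> y)" using commutator_in_three_torsion y(1) z(1) by blast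
      have yc: "y \<otimes> c = c \<otimes> y" using fixA[OF y(1,3) c(1)] y(1) c(1) by (simp add: conjg_fix_iff)
      \<comment> \<open>Exchanging \<open>y\<close> and \<open>z\<close> twice produces two factors
        \<open>c\<close>, which move to the left because \<open>y\<close> commutes with
        \<open>c\<close>; cancelling \<open>z\<close> leaves a trivial square.\<close>
      have "z = y \<otimes> (y \<otimes> z)" using y z by (simp add: m_assoc[symmetric])
      also have "\<dots> = (y \<otimes> c) \<otimes> (z \<otimes> y)" using y z c by (simp add: m_assoc)
      also have "\<dots> = c \<otimes> (y \<otimes> z) \<otimes> y" using y z c(1) by (simp add: yc m_assoc)
      also have "\<dots> = (c \<otimes> c) \<otimes> z \<otimes> (y \<otimes> y)" using y(1) z(1) c by (simp add: m_assoc)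
      also have "\<dots> = (c \<otimes> c) \<otimes> z" using y z c by simp
      finally have "c \<otimes> c = \<one>" using z(1) c(1) by (metis three_torsion_carrier m_closed r_cancel_one')
      then have "c = \<one>" using three_torsion_eq_one c(1) by blast
      then have yz: "y \<otimes> z = z \<otimes> y" using c y z by simp
      have "(y \<otimes> z) \<otimes> (y \<otimes> z) = y \<otimes> (z \<otimes> y) \<otimes> z" using y z by (simp add: m_assoc)
      also have "\<dots> = (y \<otimes> y) \<otimes> (z \<otimes> z)" unfolding yz[symmetric] using y(1) z(1) by (simp add: m_assoc)
      finally have "(y \<otimes> z) \<otimes> (y \<otimes> z) = \<one>" using y z by simp
      then show "y \<otimes> z \<in> ?E" using y z g(1) conjg_conj[of y z g] by simp
    qed auto
    fix z y assume z: "z \<in> carrier G" and "y \<in> ?E"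
    then have y: "y \<in> carrier G" "y \<otimes> y = \<one>" "conjg y g = g" by auto
    have "conjg z y \<otimes> conjg z y = \<one>" using y z by (simp add: conjg_mult[symmetric])
    moreover have "conjg (conjg z y) g = conjg z (conjg y (conjg (inv z) g))"
      using y z g(1) by (simp add: conjg_def m_assoc inv_mult_group)
    \<comment> \<open>The conjugate of \<open>g\<close> is again in the three-torsion, where
      \<open>y\<close> acts trivially.\<close>
    moreover have "conjg y (conjg (inv z) g) = conjg (inv z) g" using fixA[OF y(1,3)] z gA by simp
    moreover have "conjg z (conjg (inv z) g) = g" using z g(1) by (simp add: conjg_def m_assoc)
    ultimately show "conjg z y \<in> ?E" using y z by simp
  qed
  moreover have "g \<notin> ?E" using three_torsion_eq_one[OF gA] g(2) by blast
  ultimately have E: "?E = {\<one>}" using monolith by blast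
  \<comment> \<open>The cube of \<open>x\<close> squares to one and still centralizes
    \<open>g\<close>, so it lies in the trivial subgroup \<open>?E\<close>.\<close>
  let ?y = "x \<otimes> (x \<otimes> x)"
  have "?y \<otimes> ?y = \<one>" using exponent_6[OF x(1)] x(1) by (simp add: numeral_eq_Suc m_assoc)
  moreover have "conjg ?y g = g" using x g(1) by (simp add: conjg_conj[symmetric])
  ultimately have "?y \<in> ?E" using x(1) by simp
  then have "?y = \<one>" using E by blast
  then show ?thesis using x(1) by (intro three_torsion_I)
qed

text \<open>If the three-torsion is trivial, every subgroup generated by one element is normal of
  order at most 2, so the group is generated by \<open>g\<close>. Otherwise the group is either the
  three-torsion itself, with \<open>U\<close> trivial, or its union with one coset of an involution,
  which generates \<open>U\<close>.\<close>

lemma small_index_subgroup: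
  obtains U where "subgroup U G" "g \<notin> U" "card (carrier G) \<le> 3 * card U"
proof (cases "three_torsion = {\<one>}")
  case True
  have sq: "x \<otimes> x = \<one>" if "x \<in> carrier G" for x using square_in_three_torsion[OF that] True by blast
  have comm: "x \<otimes> y = y \<otimes> x" if xy: "x \<in> carrier G" "y \<in> carrier G" for x y
  proof -
    obtain c where "c \<in> three_torsion" "x \<otimes> y = c \<otimes> (y \<otimes> x)" using commutator_in_three_torsion[OF xy] .
    then show ?thesis using True xy by simp
  qed
  have "x \<in> {\<one>, g}" if x: "x \<in> carrier G" for x
  proof -
    have "{\<one>, x} \<lhd> G"
    proof (rule normal_conjgI)
      show "subgroup {\<one>, x} G"
        by (rule subgroupI) (use x sq[OF x] inv_equality[of x x] in auto)
      show "conjg y h \<in> {\<one>, x}" if "y \<in> carrier G" "h \<in> {\<one>, x}" for y h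
        using that x comm[of y h] conjg_fix_iff[of y h] by auto
    qed
    then show ?thesis using monolith[of "{\<one>, x}"] g(2) by auto
  qed
  then have "card (carrier G) \<le> card {\<one>, g}" by (intro card_mono) auto
  then have "card (carrier G) \<le> 3 * card {\<one>}" using g(2) by simp
  then show ?thesis using that[OF triv_subgroup] g(2) by simp
next
  case False
  note AS = three_torsion_subset[OF False]
  have cardA: "card three_torsion \<le> 3"
    using card_mono[OF _ AS(1)] card_insert_le_m1[of 3 "{g, g \<otimes> g}" \<one>] card_insert_le_m1[of 2 "{g \<otimes> g}" g] by simp
  show ?thesis
  proof (cases "\<forall>x\<in>carrier G. conjg x g = g")
    case True
    then have "carrier G \<subseteq> three_torsion" using centralizer_three_torsion[OF False] by blast
    then have "card (carrier G) \<le> card three_torsion" using card_mono finite_subset[OF AS(1)] by auto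
    then show ?thesis using that[OF triv_subgroup] g(2) cardA by simp
  next
    case nc: False
    then obtain x where x: "x \<in> carrier G" "conjg x g \<noteq> g" by blast
    \<comment> \<open>The cube of \<open>x\<close> squares to one by the exponent law and acts on
      the three-torsion as \<open>x\<close> does, because the square of \<open>x\<close> acts
      trivially.\<close>
    define t where "t = x \<otimes> (x \<otimes> x)"
    have t: "t \<in> carrier G" using x by (simp add: t_def)
    have tt: "t \<otimes> t = \<one>" using exponent_6[OF x(1)] x(1) by (simp add: t_def numeral_eq_Suc m_assoc)
    have "conjg t g = conjg x g"
      using x g(1) AS(2) by (simp add: t_def conjg_conj[symmetric] conjg_three_torsion_involution)
    then have tg: "conjg t g \<noteq> g" using x(2) by simp
    have t1: "t \<noteq> \<one>"
    proof
      assume "t = \<one>"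
      then show False using tg g(1) by (simp add: conjg_def)
    qed
    have gt: "g \<noteq> t"
    proof
      assume "g = t"
      then show False using tg t by (simp add: conjg_def m_assoc)
    qed
    have inverts: "conjg y g = inv g" if "y \<in> carrier G" "conjg y g \<noteq> g" for y
      using conjg_dichotomy[OF that(1)] that(2) AS(2) by blast
    have "carrier G \<subseteq> three_torsion \<union> (\<lambda>a. t \<otimes> a) ` three_torsion"
    proof
      fix y assume y: "y \<in> carrier G"
      show "y \<in> three_torsion \<union> (\<lambda>a. t \<otimes> a) ` three_torsion"
      proof (cases "conjg y g = g")
        case True
        then show ?thesis using centralizer_three_torsion[OF False y] by blast
      next
        case no: False
        \<comment> \<open>Both factors invert \<open>g\<close>, so their product centralizes it and
          lies in the three-torsion.\<close>
        have "conjg (t \<otimes> y) g = conjg t (conjg y g)" using t y g(1) by (simp add: conjg_conj)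
        also have "\<dots> = g" using inverts[OF y no] inverts[OF t tg] t g(1) by (simp add: conjg_inv)
        finally have "t \<otimes> y \<in> three_torsion" using centralizer_three_torsion[OF False] t y by simp
        moreover have "y = t \<otimes> (t \<otimes> y)" using t y tt by (simp add: m_assoc[symmetric])
        ultimately show ?thesis by blast
      qed
    qed
    moreover have fA: "finite three_torsion" using finite_subset[OF AS(1)] by simp
    ultimately have "card (carrier G) \<le> card (three_torsion \<union> (\<lambda>a. t \<otimes> a) ` three_torsion)" by (intro card_mono) auto
    also have "\<dots> \<le> card three_torsion + card three_torsion"
      using card_Un_le[of three_torsion "(\<lambda>a. t \<otimes> a) ` three_torsion"] card_image_le[OF fA, of "\<lambda>a. t \<otimes> a"] by linarith
    finally have "card (carrier G) \<le> 3 * card {\<one>, t}" using cardA t1 by simp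
    moreover have "subgroup {\<one>, t} G"
      by (rule subgroupI) (use t tt inv_equality[of t t] in auto)
    ultimately show ?thesis using that[of "{\<one>, t}"] g(2) gt by blast
  qed
qed

end

section \<open>The action on the cosets of a subgroup of index at most 3\<close>

lemma (in group) hom_sym_group_3:
  assumes fin: "finite (carrier G)" and U: "subgroup U G" "card (carrier G) \<le> 3 * card U"
    and g: "g \<in> carrier G" "g \<notin> U"
  obtains \<phi> where "\<phi> \<in> hom G (sym_group 3)" "\<phi> g \<noteq> \<one>\<^bsub>sym_group 3\<^esub>"
proof -
  let ?C = "rcosets U"
  have Us: "U \<subseteq> carrier G" using U(1) by (rule subgroup.subset)
  have "finite ?C" using fin rcosets_part_G[OF U(1)] finite_UnionD by metis
  have "card ?C * card U = card (carrier G)" using lagrange[OF U(1)] by (simp add: Coset.order_def)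
  moreover have "card U > 0" using subgroup.finite_imp_card_positive[OF U(1) fin] .
  ultimately have card: "card ?C \<le> 3" using U(2) by (metis mult_le_cancel2)
  obtain e where e: "bij_betw e ?C {1..card ?C}"
    using ex_bij_betw_finite_nat[OF \<open>finite ?C\<close>] bij_betw_iff_card[of ?C "{1..card ?C}"] \<open>finite ?C\<close> by auto
  define d where "d = inv_into ?C e"
  have de: "d (e c) = c" if "c \<in> ?C" for c
    using e that by (simp add: d_def bij_betw_inv_into_left)
  have ed: "e (d i) = i" "d i \<in> ?C" if "i \<in> {1..card ?C}" for i
    using e that bij_betw_inv_into[OF e] by (auto simp: d_def bij_betw_inv_into_right bij_betw_apply)
  have eC: "e c \<in> {1..card ?C}" if "c \<in> ?C" for c using e that by (rule bij_betw_apply)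
  \<comment> \<open>The inverse turns right multiplication of right cosets into a left action, so
    that products go to compositions.\<close>
  define act where "act x c = c #> inv x" for x c
  have Cs: "c \<subseteq> carrier G" if "c \<in> ?C" for c
    using rcosets_part_G[OF U(1)] that by blast
  have act_closed: "act x c \<in> ?C" if x: "x \<in> carrier G" and c: "c \<in> ?C" for x c
  proof -
    obtain y where "y \<in> carrier G" "c = U #> y" using c by (auto simp: RCOSETS_def)
    then have "act x c = U #> (y \<otimes> inv x)" using x Us by (simp add: act_def coset_mult_assoc)
    then show ?thesis using x \<open>y \<in> carrier G\<close> by (auto simp: RCOSETS_def)
  qed
  have act_mult: "act (x \<otimes> y) c = act x (act y c)" if "x \<in> carrier G" "y \<in> carrier G" "c \<in> ?C" for x y c
    using that Cs[OF that(3)] by (simp add: act_def coset_mult_assoc inv_mult_group)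
  have act_one: "act \<one> c = c" if "c \<in> ?C" for c
    using Cs[OF that] by (simp add: act_def)
  \<comment> \<open>The action is transported along the numbering \<open>e\<close>. When there are
    fewer than three cosets, the remaining points are fixed, so the result still permutes
    \<open>{1..3}\<close>.\<close>
  define \<phi> where "\<phi> x i = (if i \<in> {1..card ?C} then e (act x (d i)) else i)" for x i
  have \<phi>_mult: "\<phi> (x \<otimes> y) = \<phi> x \<circ> \<phi> y" if "x \<in> carrier G" "y \<in> carrier G" for x y
  proof
    fix i
    show "\<phi> (x \<otimes> y) i = (\<phi> x \<circ> \<phi> y) i"
    proof (cases "i \<in> {1..card ?C}")
      case True
      note act_y = act_closed[OF that(2) ed(2)[OF True]]
      have "\<phi> y i = e (act y (d i))" using True by (simp only: \<phi>_def if_True)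
      then have "\<phi> x (\<phi> y i) = e (act x (act y (d i)))"
        using eC[OF act_y] de[OF act_y] by (simp only: \<phi>_def if_True)
      moreover have "\<phi> (x \<otimes> y) i = e (act x (act y (d i)))"
        using True act_mult[OF that ed(2)[OF True]] by (simp only: \<phi>_def if_True)
      ultimately show ?thesis by simp
    qed (auto simp: \<phi>_def)
  qed
  have \<phi>_one: "\<phi> \<one> = id" by (auto simp: \<phi>_def act_one ed)
  have "\<phi> x permutes {1..3}" if x: "x \<in> carrier G" for x
  proof -
    have "\<phi> x \<circ> \<phi> (inv x) = id" "\<phi> (inv x) \<circ> \<phi> x = id"
      using \<phi>_mult[of x "inv x"] \<phi>_mult[of "inv x" x] x \<phi>_one by simp_all
    then have "bij (\<phi> x)" using o_bij by blast
    then have "\<forall>i. \<exists>!j. \<phi> x j = i" by (metis bij_pointE)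
    then have "\<phi> x permutes {1..card ?C}" unfolding permutes_def by (simp add: \<phi>_def)
    then show ?thesis by (rule permutes_subset) (use card in auto)
  qed
  then have "\<phi> \<in> hom G (sym_group 3)"
    using \<phi>_mult by (auto simp: hom_def sym_group_def)
  moreover have "\<phi> g \<noteq> id"
  proof
    assume "\<phi> g = id"
    \<comment> \<open>The coset \<open>U\<close> itself detects \<open>g\<close>: fixing it would
      put the inverse of \<open>g\<close> into \<open>U\<close>.\<close>
    have UC: "U \<in> ?C" using U(1) by (rule subgroup.subgroup_in_rcosets[OF _ is_group])
    then have "\<phi> g (e U) = e (act g U)" using eC by (simp add: \<phi>_def de)
    then have "e (act g U) = e U" using \<open>\<phi> g = id\<close> by simp
    then have "act g U = U" using de UC act_closed[OF g(1) UC] by metis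
    then have "inv g \<in> U" unfolding act_def using coset_join1[of U "inv g"] Us U(1) g(1) by simp
    then show False using subgroup.m_inv_closed[OF U(1)] g by fastforce
  qed
  ultimately show ?thesis using that by (simp add: sym_group_one)
qed

text \<open>Dividing by a normal subgroup \<open>N\<close> maximal among those avoiding
  \<open>g\<close> gives a monolithic quotient satisfying the same laws. The coset action found
  there is composed with the projection.\<close>

lemma (in S3_laws) separating_hom:
  assumes g: "g \<in> carrier G" "g \<noteq> \<one>"
  shows "\<exists>\<phi> \<in> hom G (sym_group 3). \<phi> g \<noteq> \<one>\<^bsub>sym_group 3\<^esub>"
proof -
  let ?S = "{N. N \<lhd> G \<and> g \<notin> N}"
  have "finite ?S"
    by (rule finite_subset[of _ "Pow (carrier G)"]) (use fin in \<open>auto dest: normal_imp_subgroup subgroup.subset\<close>)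
  moreover have "{\<one>} \<in> ?S" using g one_is_normal by simp
  ultimately obtain N where "N \<in> ?S" and max: "\<And>H. H \<in> ?S \<Longrightarrow> N \<subseteq> H \<Longrightarrow> N = H"
    using finite_has_maximal[of ?S] by blast
  then have N: "N \<lhd> G" "g \<notin> N" by auto
  interpret N: normal N G by (rule N(1))
  let ?Q = "G Mod N" and ?q = "\<lambda>x. N #> x"
  interpret Q: group ?Q by (rule N.factorgroup_is_group)
  have q: "?q \<in> hom G ?Q" by (rule N.r_coset_hom_Mod)
  interpret q: group_hom G ?Q ?q by (unfold_locales) (rule q)
  have Qc: "carrier ?Q = ?q ` carrier G" by (auto simp: FactGroup_def RCOSETS_def)
  have q1: "?q x = \<one>\<^bsub>?Q\<^esub> \<longleftrightarrow> x \<in> N" if "x \<in> carrier G" for x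
    using that N.rcos_const coset_join1[of N x] N.subset N.subgroup_axioms by (auto simp: FactGroup_def)
  interpret Q: monolithic_S3_laws ?Q "?q g"
  proof unfold_locales
    show "finite (carrier ?Q)" using fin Qc by simp
    show "x [^]\<^bsub>?Q\<^esub> (6 :: nat) = \<one>\<^bsub>?Q\<^esub>" if "x \<in> carrier ?Q" for x
      using that unfolding Qc by (auto simp: q.hom_nat_pow[symmetric] exponent_6)
    show "(x \<otimes>\<^bsub>?Q\<^esub> x) \<otimes>\<^bsub>?Q\<^esub> (y \<otimes>\<^bsub>?Q\<^esub> y) = (y \<otimes>\<^bsub>?Q\<^esub> y) \<otimes>\<^bsub>?Q\<^esub> (x \<otimes>\<^bsub>?Q\<^esub> x)"
      if "x \<in> carrier ?Q" "y \<in> carrier ?Q" for x y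
    proof -
      obtain a b where ab: "a \<in> carrier G" "b \<in> carrier G" "x = ?q a" "y = ?q b"
        using \<open>x \<in> carrier ?Q\<close> \<open>y \<in> carrier ?Q\<close> unfolding Qc by blast
      have "?q ((a \<otimes> a) \<otimes> (b \<otimes> b)) = ?q ((b \<otimes> b) \<otimes> (a \<otimes> a))"
        using squares_commute[OF ab(1,2)] by (rule arg_cong)
      then show ?thesis using q.hom_mult ab by simp
    qed
    show "?q g \<in> carrier ?Q" using g Qc by blast
    show "?q g \<noteq> \<one>\<^bsub>?Q\<^esub>" using g N q1 by simp
    fix H assume H: "H \<lhd> ?Q" "H \<noteq> {\<one>\<^bsub>?Q\<^esub>}"
    then interpret H: normal H ?Q by simp
    \<comment> \<open>The preimage of a nontrivial normal subgroup of the quotient is normal and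
      strictly larger than \<open>N\<close>, so maximality forces it to contain
      \<open>g\<close>.\<close>
    let ?K = "{x \<in> carrier G. ?q x \<in> H}"
    have "?K \<lhd> G"
      unfolding normal_inv_iff
    proof (intro conjI ballI)
      show "subgroup ?K G"
      proof (rule subgroupI)
        have "\<one> \<in> ?K" using H.one_closed q.hom_one by simp
        then show "?K \<noteq> {}" by blast
        show "a \<otimes> b \<in> ?K" if "a \<in> ?K" "b \<in> ?K" for a b
          using that H.m_closed[of "?q a" "?q b"] q.hom_mult[of a b] by simp
      qed auto
      show "x \<otimes> h \<otimes> inv x \<in> ?K" if "x \<in> carrier G" "h \<in> ?K" for x h
        using that H.inv_op_closed2[of "?q x" "?q h"] by simp
    qed
    moreover have "N \<subseteq> ?K"
    proof
      fix x assume x: "x \<in> N"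
      then have "?q x = \<one>\<^bsub>?Q\<^esub>" using q1 N.mem_carrier by blast
      then have "?q x \<in> H" using H.one_closed by (simp only:)
      then show "x \<in> ?K" using N.mem_carrier[OF x] by simp
    qed
    moreover have "N \<noteq> ?K"
    proof
      assume NK: "N = ?K"
      have "h = \<one>\<^bsub>?Q\<^esub>" if h: "h \<in> H" for h
      proof -
        obtain x where x: "x \<in> carrier G" "h = ?q x" using H.mem_carrier[OF h] unfolding Qc by blast
        then have "x \<in> N" using h NK by blast
        then show ?thesis using x q1 by simp
      qed
      then have "H = {\<one>\<^bsub>?Q\<^esub>}" using H.one_closed by blast
      then show False using H(2) by blast
    qed
    ultimately have "g \<in> ?K" using max[of ?K] by blast
    then show "?q g \<in> H" by simp
  qed
  obtain U where U: "subgroup U ?Q" "?q g \<notin> U" "card (carrier ?Q) \<le> 3 * card U"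
    using Q.small_index_subgroup .
  obtain \<psi> where \<psi>: "\<psi> \<in> hom ?Q (sym_group 3)" "\<psi> (?q g) \<noteq> \<one>\<^bsub>sym_group 3\<^esub>"
    using Q.hom_sym_group_3[OF Q.fin U(1,3) Q.g(1) U(2)] .
  then have "(\<lambda>x. \<psi> (?q x)) \<in> hom G (sym_group 3)"
    using hom_in_carrier[OF \<psi>(1) q.hom_closed] hom_mult[OF \<psi>(1) q.hom_closed q.hom_closed] q.hom_mult
    by (intro homI) simp_all
  then show ?thesis using \<psi>(2) by (intro bexI[of _ "\<lambda>x. \<psi> (?q x)"])
qed

text \<open>One separating homomorphism is taken for each nonidentity element. Together they form a
  map into a power of \<open>sym_group 3\<close> with trivial kernel, and its image is the required
  subgroup.\<close>

theorem (in S3_laws) generalized_S3_type: "generalized_S3_type G"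
proof -
  let ?S = "carrier G - {\<one>}"
  obtain e :: "nat \<Rightarrow> 'a" and n where e: "bij_betw e {..<n} ?S"
    using ex_bij_betw_nat_finite[of ?S] fin by (auto simp: atLeast0LessThan)
  have "\<forall>x\<in>?S. \<exists>\<phi>. \<phi> \<in> hom G (sym_group 3) \<and> \<phi> x \<noteq> \<one>\<^bsub>sym_group 3\<^esub>"
    using separating_hom by fastforce
  from bchoice[OF this] obtain \<Phi> where
    \<Phi>: "\<And>x. x \<in> ?S \<Longrightarrow> \<Phi> x \<in> hom G (sym_group 3)" "\<And>x. x \<in> ?S \<Longrightarrow> \<Phi> x x \<noteq> \<one>\<^bsub>sym_group 3\<^esub>"
    by blast
  let ?P = "product_group {..<n} (\<lambda>_. sym_group 3)"
  define \<Psi> where "\<Psi> x = (\<lambda>i\<in>{..<n}. \<Phi> (e i) x)" for x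
  have eS: "e i \<in> ?S" if "i < n" for i using e that bij_betw_apply by fastforce
  have "group ?P" by (rule product_group) (rule sym_group_is_group)
  moreover have "\<Psi> \<in> hom G ?P"
  proof (rule homI)
    show "\<Psi> x \<in> carrier ?P" if "x \<in> carrier G" for x
      using hom_in_carrier[OF \<Phi>(1)[OF eS] that] by (simp add: \<Psi>_def)
    show "\<Psi> (x \<otimes> y) = \<Psi> x \<otimes>\<^bsub>?P\<^esub> \<Psi> y" if "x \<in> carrier G" "y \<in> carrier G" for x y
      using hom_mult[OF \<Phi>(1)[OF eS] that] by (simp add: \<Psi>_def cong: restrict_cong)
  qed
  ultimately interpret \<Psi>: group_hom G ?P \<Psi>
    by (intro group_hom.intro group_hom_axioms.intro is_group)
  have "x = \<one>" if x: "x \<in> carrier G" "\<Psi> x = \<one>\<^bsub>?P\<^esub>" for x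
  proof (rule ccontr)
    assume "x \<noteq> \<one>"
    \<comment> \<open>The coordinate indexed by \<open>x\<close> itself is nontrivial at
      \<open>x\<close>.\<close>
    then obtain i where i: "i < n" "x = e i"
      using e x(1) unfolding bij_betw_def by (metis DiffI imageE lessThan_iff singletonD)
    have "\<Psi> x i = \<Phi> x x" using i by (simp add: \<Psi>_def)
    moreover have "\<Psi> x i = \<one>\<^bsub>sym_group 3\<^esub>" using x(2) i by simp
    ultimately show False using \<Phi>(2) x(1) \<open>x \<noteq> \<one>\<close> by auto
  qed
  then have "kernel G ?P \<Psi> = {\<one>}" by (auto simp: kernel_def)
  then have "inj_on \<Psi> (carrier G)" by (simp add: \<Psi>.inj_iff_trivial_ker)
  then have "\<Psi> \<in> iso G (?P\<lparr>carrier := \<Psi> ` carrier G\<rparr>)"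
    unfolding iso_def bij_betw_def using \<Psi>.hom_mult by (simp add: hom_def)
  then have "G \<cong> ?P\<lparr>carrier := \<Psi> ` carrier G\<rparr>" by (rule is_isoI)
  then show ?thesis
    unfolding generalized_S3_type_def using \<Psi>.img_is_subgroup is_group fin by blast
qed

lemma (in S3_laws) group_exponent_dvd_6: "group_exponent G dvd 6"
  unfolding group_exponent_def
  by (rule Lcm_least) (use exponent_6 pow_eq_id in auto)

section \<open>The Galois closure of a number field in the compositum of cubic fields\<close>

theorem theorem3p5:
  fixes L :: "'a :: {alg_closed_field, field_char_0} set"
  assumes "\<forall>x :: 'a. algebraic x"
    and "number_field L"
    and "L \<subseteq> Q_three_infinity"
  shows "galois_closure L \<subseteq> Q_three_infinity
    \<and> generalized_S3_type (galois_group (galois_closure L))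
    \<and> group_exponent (galois_group (galois_closure L)) dvd 6"
proof -
  let ?N = "galois_closure L"
  \<comment> \<open>The compositum is itself a Galois field containing \<open>L\<close>, so it is
    one of the fields in the intersection defining the closure.\<close>
  have sub: "?N \<subseteq> Q_three_infinity"
    unfolding galois_closure_def using galois_over_Q_three_infinity[OF assms(1)] assms(3)
    by (intro Inter_lower) simp
  have N: "subfield ?N ambient"
    unfolding galois_closure_def by (rule subfield_Inter) (simp add: galois_over_Q_def)
  obtain R where R: "finite R" "?N \<subseteq> generate_field ambient R" "\<And>f. rational_hom f \<Longrightarrow> f ` R \<subseteq> R"
    using galois_closure_finitely_generated[OF assms(1,2)] by blast
  interpret S3_laws "galois_group ?N"
    using group_galois_group[OF N] finite_galois_group[OF assms(1) N R] galois_group_laws[OF assms(1) N sub]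
    by (intro S3_laws.intro S3_laws_axioms.intro)
  show ?thesis using sub generalized_S3_type group_exponent_dvd_6 by blast
qed

end
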